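(* If $Y$ is a shift of finite type which is not NMC, then the space $\mathbf{S}(Y)$ of subshifts contained in $Y$ is homeomorphic to the Pełczyński space. In particular, the spaces $\mathbf{S}(Y)$, for $Y$ ranging over non-NMC shifts of finite type, are all homeomorphic to each other.
   Context: A subshift is a nonempty compact set $X\subset\mathbb{Z}^{\mathbb{Z}}$ (product topology, $\mathbb{Z}$ discrete) with $\sigma(X)=X$, where $(\sigma x)_i=x_{i+1}$; it is automatically over a finite alphabet. $L_n(X)$ is the set of $n$-letter words occurring in points of $X$. $\mathbf{S}$ is the set of all subshifts with the metric $d(X,Y)=2^{-\inf\{n:L_n(X)\ne L_n(Y)\}}$ ($d(X,X)=0$), and $\mathbf{S}(Y)\subset\mathbf{S}$ is the subspace of subshifts contained in $Y$. A shift of finite type is a subshift consisting of all points of $\mathcal{A}^{\mathbb{Z}}$ ($\mathcal{A}$ finite) containing no word from some fixed finite set of words. The $n$th Rauzy graph $G_{X,n}$ is the directed graph with vertex set $L_{n-1}(X)$ and, for each $w_1\cdots w_n\in L_n(X)$, an edge from $w_1\cdots w_{n-1}$ to $w_2\cdots w_n$. A directed graph has the no middle cycles property (NMC) if it contains no cycle $K$ which has both an incoming edge (an edge whose terminal vertex is in $K$ and whose initial vertex is not in $K$) and an outgoing edge (an edge whose initial vertex is in $K$ and whose terminal vertex is not in $K$). A subshift $X$ is NMC if there exists $n\ge2$ for which $G_{X,n}$ has NMC. The Pełczyński space is the compact zero-dimensional metric space, unique up to homeomorphism (a theorem of Pełczyński), which has a dense set of isolated points whose complement is homeomorphic to the Cantor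 set. *)

theory Defs
  imports "HOL-Analysis.Analysis" "Graph_Theory.Arc_Walk"
begin

section \<open>Subshifts\<close>

definition shift :: "(int \<Rightarrow> int) \<Rightarrow> (int \<Rightarrow> int)" where
  "shift x = (\<lambda>i. x (i + 1))"

text \<open>
  Here \<open>compact\<close> refers to the product topology on \<^typ>\<open>int \<Rightarrow> int\<close>
  (theory \<open>HOL-Analysis.Function_Topology\<close>), where \<^typ>\<open>int\<close> is discrete.
\<close>

definition subshift :: "(int \<Rightarrow> int) set \<Rightarrow> bool" where
  "subshift X \<longleftrightarrow> X \<noteq> {} \<and> compact X \<and> shift ` X = X"

definition occurs_in :: "int list \<Rightarrow> (int \<Rightarrow> int) \<Rightarrow> bool" where
  "occurs_in w x \<longleftrightarrow> (\<exists>i. w = map (\<lambda>k. x (i + int k)) [0..<length w])"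

definition lang :: "nat \<Rightarrow> (int \<Rightarrow> int) set \<Rightarrow> int list set" where
  "lang n X = {w. length w = n \<and> (\<exists>x\<in>X. occurs_in w x)}"

definition shift_of_finite_type :: "(int \<Rightarrow> int) set \<Rightarrow> bool" where
  "shift_of_finite_type X \<longleftrightarrow> subshift X \<and>
     (\<exists>A F. finite A \<and> finite F \<and>
        X = {x. range x \<subseteq> A \<and> (\<forall>w\<in>F. \<not> occurs_in w x)})"

section \<open>Rauzy graphs and the no middle cycles property\<close>

text \<open>The arcs are the \<open>n\<close>-letter words themselves.\<close>

definition rauzy_graph :: "(int \<Rightarrow> int) set \<Rightarrow> nat \<Rightarrow> (int list, int list) pre_digraph" where
  "rauzy_graph X n =
     \<lparr>verts = lang (n - 1) X, arcs = lang n X, tail = butlast, head = tl\<rparr>"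

definition has_incoming_arc :: "('a, 'b) pre_digraph \<Rightarrow> 'a set \<Rightarrow> bool" where
  "has_incoming_arc G K \<longleftrightarrow> (\<exists>e\<in>arcs G. head G e \<in> K \<and> tail G e \<notin> K)"

definition has_outgoing_arc :: "('a, 'b) pre_digraph \<Rightarrow> 'a set \<Rightarrow> bool" where
  "has_outgoing_arc G K \<longleftrightarrow> (\<exists>e\<in>arcs G. tail G e \<in> K \<and> head G e \<notin> K)"

text \<open>
  A cycle is a nonempty closed walk without repeated vertices, given as its list \<open>p\<close> of arcs
  (loops are cycles of length one). Its vertex set is the set of tails of the arcs in \<open>p\<close>.
\<close>

definition no_middle_cycles :: "('a, 'b) pre_digraph \<Rightarrow> bool" where
  "no_middle_cycles G \<longleftrightarrow>
     \<not> (\<exists>p. pre_digraph.cycle G p \<and>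
           has_incoming_arc G (tail G ` set p) \<and> has_outgoing_arc G (tail G ` set p))"

definition NMC :: "(int \<Rightarrow> int) set \<Rightarrow> bool" where
  "NMC X \<longleftrightarrow> (\<exists>n\<ge>2. no_middle_cycles (rauzy_graph X n))"

section \<open>The space of subshifts\<close>

definition subshift_dist :: "(int \<Rightarrow> int) set \<Rightarrow> (int \<Rightarrow> int) set \<Rightarrow> real" where
  "subshift_dist X Y = (if X = Y then 0 else (1 / 2) ^ Inf {n. lang n X \<noteq> lang n Y})"

lemma subshift_translate:
  assumes "subshift Y" "y \<in> Y"
  shows "(\<lambda>k. y (k + m)) \<in> Y"
proof (induction m rule: int_induct[where k = 0])
  case base
  then show ?case using assms by simp
next
  case (step1 i)
  then have "shift (\<lambda>k. y (k + i)) \<in> Y"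
    using assms unfolding subshift_def by blast
  then show ?case by (simp add: shift_def algebra_simps)
next
  case (step2 i)
  then obtain z where z: "z \<in> Y" "(\<lambda>k. y (k + i)) = shift z"
    using assms unfolding subshift_def by blast
  have "z k = y (k + (i - 1))" for k
    using fun_cong[OF z(2), of "k - 1"] by (simp add: shift_def algebra_simps)
  then have "z = (\<lambda>k. y (k + (i - 1)))" by blast
  then show ?case using z(1) by simp
qed

lemma subshift_subset_if_lang_eq:
  assumes X: "subshift X" and Y: "subshift Y" and eq: "\<And>n. lang n X = lang n Y"
  shows "X \<subseteq> Y"
proof
  fix x assume x: "x \<in> X"
  have "\<exists>y\<in>Y. \<forall>k. \<bar>k\<bar> \<le> int n \<longrightarrow> y k = x k" for n
  proof -
    define w where "w = map (\<lambda>k. x (- int n + int k)) [0..<2 * n + 1]"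
    have len: "length w = 2 * n + 1" by (simp add: w_def)
    have "occurs_in w x" unfolding occurs_in_def len by (rule exI[of _ "- int n"]) (simp add: w_def)
    then have "w \<in> lang (2 * n + 1) Y" using x len eq unfolding lang_def by blast
    then obtain y j where y: "y \<in> Y" "w = map (\<lambda>k. y (j + int k)) [0..<2 * n + 1]"
      unfolding lang_def occurs_in_def by (smt (verit) mem_Collect_eq)
    define z where "z = (\<lambda>k. y (k + (j + int n)))"
    have "z k = x k" if "\<bar>k\<bar> \<le> int n" for k
    proof -
      have lt: "nat (k + int n) < 2 * n + 1" using that by linarith
      have "w ! nat (k + int n) = x (- int n + int (nat (k + int n)))"
        using lt unfolding w_def by (simp del: upt_Suc)
      moreover have "w ! nat (k + int n) = y (j + int (nat (k + int n)))"
        using lt unfolding y(2) by (simp del: upt_Suc)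
      moreover have "int (nat (k + int n)) = k + int n" using that by linarith
      ultimately show ?thesis by (simp add: z_def algebra_simps)
    qed
    moreover have "z \<in> Y" unfolding z_def by (rule subshift_translate[OF Y y(1)])
    ultimately show ?thesis by blast
  qed
  then obtain f where f: "\<And>n. f n \<in> Y" "\<And>n k. \<bar>k\<bar> \<le> int n \<Longrightarrow> f n k = x k"
    by metis
  have "f \<longlonglongrightarrow> x"
  proof -
    have "(\<lambda>n. f n i) \<longlonglongrightarrow> x i" for i
    proof (rule tendsto_eventually)
      show "eventually (\<lambda>n. f n i = x i) sequentially"
        by (rule eventually_sequentiallyI[of "nat \<bar>i\<bar>"]) (use f(2) in auto)
    qed
    then have "limitin (product_topology (\<lambda>i. euclidean) UNIV) f x sequentially"
      by (simp add: limitin_componentwise)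
    then show ?thesis by (simp add: euclidean_product_topology)
  qed
  moreover have "closed Y"
  proof -
    have "(euclidean :: int topology) = discrete_topology UNIV"
      by (simp add: topology_eq open_discrete)
    then have "Hausdorff_space (product_topology (\<lambda>i::int. euclidean :: int topology) UNIV)"
      by (simp add: Hausdorff_space_product_topology)
    then have "Hausdorff_space (euclidean :: (int \<Rightarrow> int) topology)"
      by (simp add: euclidean_product_topology)
    then have "closedin euclidean Y"
      using Y unfolding subshift_def by (intro compactin_imp_closedin) auto
    then show ?thesis by simp
  qed
  ultimately show "x \<in> Y" using f(1) closed_sequentially by blast
qed

interpretation subshift_space: Metric_space "Collect subshift" subshift_dist
proof
  show "0 \<le> subshift_dist X Y" for X Y by (simp add: subshift_dist_def)
  show "subshift_dist X Y = subshift_dist Y X" for X Y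
    by (simp add: subshift_dist_def eq_commute)
  show "subshift_dist X Y = 0 \<longleftrightarrow> X = Y" for X Y by (simp add: subshift_dist_def)
next
  fix X Y Z
  assume mem: "X \<in> Collect subshift" "Y \<in> Collect subshift" "Z \<in> Collect subshift"
  show "subshift_dist X Z \<le> subshift_dist X Y + subshift_dist Y Z"
  proof (cases "X = Y \<or> Y = Z \<or> X = Z")
    case True
    then show ?thesis by (auto simp: subshift_dist_def)
  next
    case False
    let ?D = "\<lambda>X Y. {n. lang n X \<noteq> lang n Y}"
    have "?D X Z \<noteq> {}"
      using False mem subshift_subset_if_lang_eq[of X Z] subshift_subset_if_lang_eq[of Z X] by auto
    then have "Inf (?D X Z) \<in> ?D X Z" by (rule Inf_nat_def1)
    then have "Inf (?D X Z) \<in> ?D X Y \<or> Inf (?D X Z) \<in> ?D Y Z" by auto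
    then have "Inf (?D X Y) \<le> Inf (?D X Z) \<or> Inf (?D Y Z) \<le> Inf (?D X Z)"
      by (meson wellorder_Inf_le1)
    then have "(1 / 2) ^ Inf (?D X Z) \<le> (1 / 2 :: real) ^ Inf (?D X Y) \<or>
               (1 / 2) ^ Inf (?D X Z) \<le> (1 / 2 :: real) ^ Inf (?D Y Z)"
      using power_decreasing[of _ _ "1 / 2 :: real"] by fastforce
    then show ?thesis using False by (auto simp: subshift_dist_def add_increasing add_increasing2)
  qed
qed

text \<open>The topological space of all subshifts contained in \<open>Y\<close>.\<close>

definition subshifts_in :: "(int \<Rightarrow> int) set \<Rightarrow> (int \<Rightarrow> int) set topology" where
  "subshifts_in Y = subtopology subshift_space.mtopology {X. subshift X \<and> X \<subseteq> Y}"

section \<open>The Pelczynski space\<close>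

definition cantor_set :: "real set" where
  "cantor_set = {\<Sum>n. 2 * of_bool (a n) / 3 ^ Suc n | a :: nat \<Rightarrow> bool. True}"

definition isolated_points :: "'a topology \<Rightarrow> 'a set" where
  "isolated_points T = {x \<in> topspace T. openin T {x}}"

definition zero_dimensional :: "'a topology \<Rightarrow> bool" where
  "zero_dimensional T \<longleftrightarrow> neighbourhood_base_of (\<lambda>U. openin T U \<and> closedin T U) T"

text \<open>
  By Pelczynski's theorem these conditions determine the space up to homeomorphism.
  A dense set of isolated points contains every isolated point, so it is \<open>isolated_points T\<close>.
\<close>

definition pelczynski_space :: "'a topology \<Rightarrow> bool" where
  "pelczynski_space T \<longleftrightarrow>
     compact_space T \<and> metrizable_space T \<and> zero_dimensional T \<and>
     T closure_of isolated_points T = topspace T \<and>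
     subtopology T (topspace T - isolated_points T) homeomorphic_space top_of_set cantor_set"

end

(*
  The space of subshifts of Y is a compact ultrametric space, and a compact metrizable space with
  dense isolated points is determined by its remainder, so it suffices to see that the isolated
  points of the space are dense and that the remainder is perfect and nonempty.

  A subshift is recorded by the sets of its words of each length, and a set of words of length n + 1
  extends such a record as soon as every word of length n is both a prefix and a suffix of one of its
  elements. If long words of X are never bispecial (at least two left and at least two right
  extensions), the words of X of some length determine X, and X is isolated. Choosing the two-sided
  extensions of bispecial words sparingly makes the first difference of the complexity drop at each
  bispecial word, so after finitely many choices none is left: the isolated points are dense.
  A non-isolated subshift has arbitrarily long bispecial words, and these pass through a cycle of the
  Rauzy graph which is both entered and left. Conversely, forbidding one long word which enters the
  cycle, turns around it and leaves it changes a shift of finite type without destroying the cycle;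
  hence shifts of finite type with such cycles are limits of non-isolated subshifts.
*)

theory Submission
  imports Defs
begin

section \<open>Compact metrizable spaces with dense isolated points\<close>

text \<open>Balls of radius \<open>(1 / 2) ^ n\<close> are the classes of subshifts with the same
  words of length n, so isolation can be stated as \<open>lang_determined\<close>, without reference
  to the ambient shift \<open>Y\<close>. Finite type of \<open>Y\<close> is what carries this over
  to the subspace: subshifts sharing sufficiently long words with a subshift of \<open>Y\<close> lie
  in \<open>Y\<close> themselves, so approximants are built without regard to \<open>Y\<close>. A
  non-isolated subshift need not be of finite type, and the modification along a cycle applies only
  to shifts of finite type. It is therefore applied to a finite type approximation, which inherits
  the cycle and is itself non-isolated. Cycles are kept as periodic sequences rather than as simple
  cycles: the sequence read between two occurrences of a window may revisit vertices, and this form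
  is preserved when passing to longer words. In the topological part, isolated points are matched
  greedily, so an extension of a homeomorphism of the remainders need not be onto. This is why two
  injections, one in each direction, have to be merged.\<close>

lemma openin_isolated_points:
  assumes "S \<subseteq> isolated_points T"
  shows "openin T S"
proof -
  have "openin T (\<Union>x\<in>S. {x})"
    using assms by (intro openin_Union) (auto simp: isolated_points_def)
  then show ?thesis by simp
qed

lemma isolated_points_subset: "isolated_points T \<subseteq> topspace T"
  by (auto simp: isolated_points_def)

context Metric_space
begin

lemma isolated_point_ball:
  assumes "x \<in> isolated_points mtopology"
  obtains r where "r > 0" "\<And>y. y \<in> M \<Longrightarrow> d x y < r \<Longrightarrow> y = x"
proof -
  have "x \<in> M" "openin mtopology {x}" using assms by (auto simp: isolated_points_def)
  then obtain r where "r > 0" "mball x r \<subseteq> {x}" unfolding openin_mtopology by blast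
  then show ?thesis using that \<open>x \<in> M\<close> by (metis in_mball singletonD subsetD)
qed

text \<open>Once the radius of a finite net is below the isolation radius of a point, that point
  must be a centre of the net. The countably many nets of radius \<open>1 / real (Suc n)\<close>
  thus contain all isolated points.\<close>

lemma countable_isolated_points:
  assumes "compact_space mtopology"
  shows "countable (isolated_points mtopology)"
proof -
  have "mtotally_bounded M"
    using assms compact_space_eq_mcomplete_mtotally_bounded by blast
  then have "\<exists>K. finite K \<and> K \<subseteq> M \<and> M \<subseteq> (\<Union>x\<in>K. mball x (1 / real (Suc n)))" for n
    unfolding mtotally_bounded_def by simp
  then obtain K where K: "\<And>n. finite (K n)" "\<And>n. K n \<subseteq> M"
    "\<And>n. M \<subseteq> (\<Union>x\<in>K n. mball x (1 / real (Suc n)))" by metis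
  have "isolated_points mtopology \<subseteq> (\<Union>n. K n)"
  proof
    fix p assume p: "p \<in> isolated_points mtopology"
    then have pM: "p \<in> M" by (simp add: isolated_points_def)
    obtain r where r: "r > 0" "\<And>y. y \<in> M \<Longrightarrow> d p y < r \<Longrightarrow> y = p"
      using isolated_point_ball[OF p] by blast
    obtain n where n: "1 / real (Suc n) < r" using r(1) nat_approx_posE by blast
    obtain x where x: "x \<in> K n" "p \<in> mball x (1 / real (Suc n))" using K(3) pM by blast
    then have "x = p" using r(2)[of x] K(2) n by (auto simp: commute)
    then show "p \<in> (\<Union>n. K n)" using x by blast
  qed
  then show ?thesis using K(1) by (meson countable_UN countable_finite countable_subset countableI_type)
qed

lemma infinite_isolated_points_near:
  assumes "mtopology closure_of isolated_points mtopology = M" "x \<in> M - isolated_points mtopology" "e > 0"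
  shows "infinite (isolated_points mtopology \<inter> mball x e)"
proof -
  have "x \<in> mtopology derived_set_of isolated_points mtopology"
    using assms(1,2) by (auto simp: closure_of)
  then show ?thesis using assms(3) by (simp add: derived_set_of_infinite_mball)
qed

lemma isolated_points_approximating:
  assumes "mtopology closure_of isolated_points mtopology = M"
    and c: "\<And>n :: nat. c n \<in> M - isolated_points mtopology"
  obtains f where "inj f" "\<And>n. f n \<in> isolated_points mtopology" "\<And>n. d (c n) (f n) < 1 / real (Suc n)"
proof -
  define P where "P f n y \<longleftrightarrow> y \<in> isolated_points mtopology \<and> d (c n) y < 1 / real (Suc n) \<and> y \<notin> f ` {..<n}"
    for f n y
  have "\<exists>f. \<forall>n. P f n (f n)"
  proof (rule dependent_wellorder_choice)
    show "P f n y = P g n y" if "\<And>k. k < n \<Longrightarrow> f k = g k" for y f g n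
      using that by (auto simp: P_def image_def)
    show "\<exists>y. P f n y" for n f
    proof -
      have "infinite (isolated_points mtopology \<inter> mball (c n) (1 / real (Suc n)))"
        by (rule infinite_isolated_points_near[OF assms]) simp
      then have "infinite (isolated_points mtopology \<inter> mball (c n) (1 / real (Suc n)) - f ` {..<n})"
        by (simp add: Diff_infinite_finite)
      then obtain y where "y \<in> isolated_points mtopology \<inter> mball (c n) (1 / real (Suc n)) - f ` {..<n}"
        by (metis finite.emptyI ex_in_conv)
      then show ?thesis by (auto simp: P_def)
    qed
  qed
  then obtain f where f: "\<And>n. P f n (f n)" by blast
  have "inj f"
  proof (rule linorder_injI)
    fix i j :: nat assume "i < j"
    then have "f i \<in> f ` {..<j}" by simp
    then show "f i \<noteq> f j" using f[of j] unfolding P_def by metis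
  qed
  then show ?thesis using that[of f] f by (simp add: P_def)
qed

end

text \<open>
  An isolated point \<open>x\<close> is sent to an unused isolated point near the image of an almost nearest
  non-isolated point \<open>r x\<close>.
\<close>

lemma isolated_points_extension:
  fixes P :: "'a topology" and Q :: "'b topology"
  assumes cP: "compact_space P" and mP: "metrizable_space P" and mQ: "metrizable_space Q"
    and ne: "topspace P - isolated_points P \<noteq> {}"
    and dQ: "Q closure_of isolated_points Q = topspace Q"
    and h: "continuous_map (subtopology P (topspace P - isolated_points P))
              (subtopology Q (topspace Q - isolated_points Q)) h"
    and injh: "inj_on h (topspace P - isolated_points P)"
  obtains f where "continuous_map P Q f" "inj_on f (topspace P)"
    "f ` isolated_points P \<subseteq> isolated_points Q"
    "\<And>x. x \<in> topspace P - isolated_points P \<Longrightarrow> f x = h x"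
proof -
  obtain M d where Md: "Metric_space M d" "P = Metric_space.mtopology M d"
    using mP unfolding metrizable_space_def by blast
  obtain N e where Ne: "Metric_space N e" "Q = Metric_space.mtopology N e"
    using mQ unfolding metrizable_space_def by blast
  interpret P: Metric_space M d by fact
  interpret Q: Metric_space N e by fact
  have PM: "topspace P = M" and QN: "topspace Q = N" using Md(2) Ne(2) by simp_all
  define D where "D = isolated_points P"
  define P' where "P' = M - D"
  define Q' where "Q' = N - isolated_points Q"
  have ne': "P' \<noteq> {}" using ne by (simp add: P'_def D_def PM)
  have DM: "D \<subseteq> M" using isolated_points_subset[of P] PM by (simp add: D_def)
  have hQ: "h x \<in> Q'" if "x \<in> P'" for x
    using continuous_map_image_subset_topspace[OF h] that by (auto simp: PM QN P'_def Q'_def D_def)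
  \<comment> \<open>The distance from \<open>x\<close> to \<open>P'\<close> is positive because
    \<open>x\<close> is isolated, so it is strictly below its double and some point of
    \<open>P'\<close> comes that close.\<close>
  have "\<exists>r\<in>P'. \<forall>z\<in>P'. d x r \<le> 2 * d x z" if x: "x \<in> D" for x
  proof -
    obtain \<epsilon> where eps: "\<epsilon> > 0" "\<And>y. y \<in> M \<Longrightarrow> d x y < \<epsilon> \<Longrightarrow> y = x"
      using P.isolated_point_ball x unfolding D_def Md(2) by blast
    have low: "\<epsilon> \<le> d x z" if "z \<in> P'" for z
      using eps(2)[of z] that x unfolding P'_def by force
    define \<delta> where "\<delta> = Inf (d x ` P')"
    have "\<epsilon> \<le> \<delta>" unfolding \<delta>_def using ne' low by (intro cInf_greatest) auto
    then have "Inf (d x ` P') < 2 * \<delta>" using eps(1) by (simp add: \<delta>_def)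
    then obtain r where r: "r \<in> P'" "d x r < 2 * \<delta>" using cInf_lessD[of "d x ` P'"] ne' by blast
    have "\<delta> \<le> d x z" if "z \<in> P'" for z
      unfolding \<delta>_def using that low by (intro cInf_lower) (auto intro!: bdd_belowI[of _ 0])
    then show ?thesis using r by (intro bexI[of _ r]) force+
  qed
  then obtain r where r: "\<And>x. x \<in> D \<Longrightarrow> r x \<in> P'" "\<And>x z. x \<in> D \<Longrightarrow> z \<in> P' \<Longrightarrow> d x (r x) \<le> 2 * d x z"
    by metis
  have cD: "countable D" using P.countable_isolated_points cP unfolding D_def Md(2) by blast
  define idx where "idx = to_nat_on D"
  have idx: "inj_on idx D" unfolding idx_def using cD by (rule inj_on_to_nat_on)
  obtain p0 where p0: "p0 \<in> P'" using ne' by blast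
  \<comment> \<open>The approximating sequence is indexed by all naturals; numbers that code no
    isolated point get the default centre \<open>h p0\<close>.\<close>
  define c where "c n = (if n \<in> idx ` D then h (r (inv_into D idx n)) else h p0)" for n
  have "c n \<in> N - isolated_points Q.mtopology" for n
    using hQ r(1) p0 inv_into_into[of n idx D] unfolding c_def Q'_def Ne(2) by auto
  then obtain F where F: "inj F" "\<And>n. F n \<in> isolated_points Q" "\<And>n. e (c n) (F n) < 1 / real (Suc n)"
    using Q.isolated_points_approximating[of c] dQ QN unfolding Ne(2) by metis
  define f where "f x = (if x \<in> D then F (idx x) else h x)" for x
  have close: "e (h (r x)) (f x) < 1 / real (Suc (idx x))" if "x \<in> D" for x
    using F(3)[of "idx x"] that idx by (simp add: f_def c_def)
  have fM: "f x \<in> N" if "x \<in> M" for x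
    using hQ[of x] F(2)[of "idx x"] isolated_points_subset[of Q] QN that
    by (auto simp: f_def P'_def Q'_def)
  have cont: "continuous_map P Q f"
    unfolding Md(2) Ne(2) P.metric_continuous_map[OF Ne(1)]
  proof (intro conjI ballI allI impI)
    show "f ` M \<subseteq> N" using fM by blast
    fix a and \<epsilon> :: real assume a: "a \<in> M" and eps: "0 < \<epsilon>"
    show "\<exists>\<delta>>0. \<forall>x. x \<in> M \<and> d a x < \<delta> \<longrightarrow> e (f a) (f x) < \<epsilon>"
    proof (cases "a \<in> D")
      case True
      then obtain \<delta> where "\<delta> > 0" "\<And>y. y \<in> M \<Longrightarrow> d a y < \<delta> \<Longrightarrow> y = a"
        using P.isolated_point_ball unfolding D_def Md(2) by blast
      then show ?thesis using fM[OF a] eps by (metis Q.mdist_zero)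
    next
      case False
      then have aP: "a \<in> P'" using a by (simp add: P'_def)
      have "continuous_map (subtopology P P') Q h"
        using h unfolding P'_def D_def PM continuous_map_in_subtopology by blast
      then obtain U where U: "openin (subtopology P P') U" "a \<in> U"
        "\<And>y. y \<in> U \<Longrightarrow> h y \<in> Q.mball (h a) (\<epsilon> / 2)"
        unfolding Ne(2) Q.continuous_map_to_metric using aP a eps PM
        by (metis IntI half_gt_zero topspace_subtopology)
      obtain T where T: "openin P T" "U = T \<inter> P'" using U(1) unfolding openin_subtopology by blast
      then obtain \<delta>1 where d1: "\<delta>1 > 0" "P.mball a \<delta>1 \<subseteq> T"
        using U(2) unfolding Md(2) P.openin_mtopology by blast
      have near: "e (h a) (h y) < \<epsilon> / 2" if "y \<in> P'" "d a y < \<delta>1" for y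
      proof -
        have "y \<in> P.mball a \<delta>1" using that a by (simp add: P'_def)
        then have "y \<in> U" using T d1 that by blast
        then show ?thesis using U(3) by auto
      qed
      obtain n where n: "1 / real (Suc n) < \<epsilon> / 2" using eps nat_approx_posE half_gt_zero by blast
      \<comment> \<open>Only these finitely many isolated points may be sent farther than
        \<open>1 / real (Suc n)\<close> from their centres, and \<open>a\<close>, being
        non-isolated, has positive distance to each. The \<open>insert 1\<close> below covers empty
        \<open>K\<close>.\<close>
      define K where "K = {x \<in> D. idx x < n}"
      have "finite (idx ` K)" by (rule finite_subset[of _ "{..<n}"]) (auto simp: K_def)
      moreover have "inj_on idx K" using idx by (rule inj_on_subset) (auto simp: K_def)
      ultimately have finK: "finite K" by (rule finite_imageD)
      define \<delta>2 where "\<delta>2 = Min (insert 1 (d a ` K))"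
      have "0 < d a x" if "x \<in> K" for x using that False a DM by (auto simp: K_def)
      then have d2: "\<delta>2 > 0" unfolding \<delta>2_def using finK by (subst Min_gr_iff) auto
      have d2': "\<delta>2 \<le> d a x" if "x \<in> K" for x
        unfolding \<delta>2_def using finK that by (intro Min_le) auto
      show ?thesis
      proof (intro exI conjI allI impI)
        \<comment> \<open>The factor 3 arises from \<open>d a (r x) \<le> d a x + d x (r x)\<close>,
          where the last term is at most \<open>2 * d a x\<close>.\<close>
        show "0 < min (\<delta>1 / 3) \<delta>2" using d1 d2 by simp
        fix x assume x: "x \<in> M \<and> d a x < min (\<delta>1 / 3) \<delta>2"
        have fa: "f a = h a" using False by (simp add: f_def)
        show "e (f a) (f x) < \<epsilon>"
        proof (cases "x \<in> D")
          case False
          then have "e (h a) (h x) < \<epsilon> / 2" using x d1 by (intro near) (auto simp: P'_def)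
          then show ?thesis using False fa eps by (simp add: f_def)
        next
          case True
          have rx: "r x \<in> P'" "d x (r x) \<le> 2 * d x a" using r True aP by auto
          then have rM: "r x \<in> M" by (simp add: P'_def)
          have "d a (r x) \<le> d a x + d x (r x)" using a x rM by (intro P.triangle) auto
          then have "d a (r x) < \<delta>1" using rx x P.commute[of a x] by linarith
          then have 1: "e (h a) (h (r x)) < \<epsilon> / 2" using near rx by blast
          have "x \<notin> K" using d2' x by force
          then have "n \<le> idx x" using True by (simp add: K_def)
          then have "1 / real (Suc (idx x)) \<le> 1 / real (Suc n)" by (simp add: frac_le)
          then have 2: "e (h (r x)) (f x) < \<epsilon> / 2" using close[OF True] n by linarith
          have "h a \<in> N" "h (r x) \<in> N" using hQ aP rx by (auto simp: Q'_def)
          then have "e (h a) (f x) \<le> e (h a) (h (r x)) + e (h (r x)) (f x)"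
            using fM x by (intro Q.triangle) auto
          then show ?thesis using 1 2 unfolding fa by linarith
        qed
      qed
    qed
  qed
  have "inj_on f M"
  proof (rule inj_onI)
    fix x y assume xy: "x \<in> M" "y \<in> M" "f x = f y"
    have fz: "f z \<in> isolated_points Q \<longleftrightarrow> z \<in> D" if "z \<in> M" for z
      using that hQ[of z] F(2) by (auto simp: f_def P'_def Q'_def)
    have "x \<in> D \<longleftrightarrow> y \<in> D" using fz[OF xy(1)] fz[OF xy(2)] xy(3) by simp
    then consider "x \<in> D" "y \<in> D" | "x \<in> P'" "y \<in> P'" using xy(1,2) by (auto simp: P'_def)
    then show "x = y"
    proof cases
      case 1
      then show ?thesis using xy(3) F(1) idx by (auto simp: f_def inj_eq inj_onD)
    next
      case 2
      then show ?thesis using xy(3) injh by (auto simp: f_def P'_def D_def PM dest: inj_onD)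
    qed
  qed
  moreover have "f ` isolated_points P \<subseteq> isolated_points Q" using F(2) by (auto simp: f_def D_def)
  moreover have "f x = h x" if "x \<in> topspace P - isolated_points P" for x
    using that by (simp add: f_def D_def)
  ultimately show ?thesis using that cont PM by blast
qed

text \<open>
  The extensions of a homeomorphism of the remainders and of its inverse are combined as in the proof
  of the Schroeder-Bernstein theorem: both pieces become closed after adding the remainder.
\<close>

theorem homeomorphic_if_homeomorphic_remainders:
  fixes P :: "'a topology" and Q :: "'b topology"
  assumes cP: "compact_space P" and mP: "metrizable_space P"
    and dP: "P closure_of isolated_points P = topspace P"
    and cQ: "compact_space Q" and mQ: "metrizable_space Q"
    and dQ: "Q closure_of isolated_points Q = topspace Q"
    and ne: "topspace P - isolated_points P \<noteq> {}"
    and hom: "subtopology P (topspace P - isolated_points P) homeomorphic_space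
              subtopology Q (topspace Q - isolated_points Q)"
  shows "P homeomorphic_space Q"
proof -
  define P' where "P' = topspace P - isolated_points P"
  define Q' where "Q' = topspace Q - isolated_points Q"
  have tP': "topspace (subtopology P P') = P'" and tQ': "topspace (subtopology Q Q') = Q'"
    by (auto simp: P'_def Q'_def)
  obtain h k where "homeomorphic_maps (subtopology P P') (subtopology Q Q') h k"
    using hom unfolding homeomorphic_space_def P'_def Q'_def by blast
  then have h: "continuous_map (subtopology P P') (subtopology Q Q') h"
    and k: "continuous_map (subtopology Q Q') (subtopology P P') k"
    and kh: "\<And>x. x \<in> P' \<Longrightarrow> k (h x) = x" and hk: "\<And>y. y \<in> Q' \<Longrightarrow> h (k y) = y"
    unfolding homeomorphic_maps_def tP' tQ' by auto
  have hQ: "\<And>x. x \<in> P' \<Longrightarrow> h x \<in> Q'" and kP: "\<And>y. y \<in> Q' \<Longrightarrow> k y \<in> P'"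
    using continuous_map_image_subset_topspace[OF h] continuous_map_image_subset_topspace[OF k] tP' tQ'
    by auto
  have injh: "inj_on h P'" and injk: "inj_on k Q'" using kh hk by (metis inj_onI)+
  obtain f where f: "continuous_map P Q f" "inj_on f (topspace P)"
    "f ` isolated_points P \<subseteq> isolated_points Q" "\<And>x. x \<in> P' \<Longrightarrow> f x = h x"
    using isolated_points_extension[OF cP mP mQ ne dQ h[unfolded P'_def Q'_def] injh[unfolded P'_def]]
    unfolding P'_def by metis
  have ne': "topspace Q - isolated_points Q \<noteq> {}" using ne hQ unfolding P'_def Q'_def by blast
  obtain g where g: "continuous_map Q P g" "inj_on g (topspace Q)"
    "g ` isolated_points Q \<subseteq> isolated_points P" "\<And>y. y \<in> Q' \<Longrightarrow> g y = k y"
    using isolated_points_extension[OF cQ mQ mP ne' dP k[unfolded P'_def Q'_def] injk[unfolded Q'_def]]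
    unfolding Q'_def by metis
  have "embedding_map Q P g"
    using g mP cQ by (intro continuous_imp_embedding_map metrizable_imp_Hausdorff_space) auto
  then obtain gi where gi: "homeomorphic_maps Q (subtopology P (g ` topspace Q)) g gi"
    unfolding embedding_map_def homeomorphic_map_maps by blast
  then have gi_cont: "continuous_map (subtopology P (g ` topspace Q)) Q gi"
    and gi_g: "\<And>y. y \<in> topspace Q \<Longrightarrow> gi (g y) = y"
    unfolding homeomorphic_maps_def by auto
  have fB: "f x \<in> topspace Q" if "x \<in> topspace P" for x
    using continuous_map_image_subset_topspace[OF f(1)] that by blast
  \<comment> \<open>Outside \<open>A\<close> lie exactly the images under \<open>g\<close> of the
    points that \<open>f\<close> misses on \<open>A\<close>. Hence \<open>gi\<close> maps the
    complement of \<open>A\<close> onto the complement of the image of \<open>A\<close> under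
    \<open>f\<close>.\<close>
  define A where "A = lfp (\<lambda>X. topspace P - g ` (topspace Q - f ` X))"
  have "mono (\<lambda>X. topspace P - g ` (topspace Q - f ` X))" by (intro monoI) blast
  then have A: "A = topspace P - g ` (topspace Q - f ` A)"
    unfolding A_def by (rule lfp_unfold)
  \<comment> \<open>On the remainder both \<open>f\<close> and \<open>gi\<close> equal
    \<open>h\<close>, so the two closed pieces may overlap there.\<close>
  have gi_h: "gi x = h x" and P'_g: "x \<in> g ` topspace Q" if "x \<in> P'" for x
  proof -
    have "g (h x) = x" "h x \<in> topspace Q" using that hQ kh g(4) unfolding Q'_def by auto
    then show "gi x = h x" "x \<in> g ` topspace Q" using gi_g by (metis, metis image_eqI)
  qed
  define \<phi> where "\<phi> x = (if x \<in> A then f x else gi x)" for x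
  define S where "S b = (if b then A \<union> P' else (topspace P - A) \<union> P')" for b
  have "continuous_map P Q \<phi>"
  proof (rule pasting_lemma_closed[where I = UNIV and T = S and f = "\<lambda>b. if b then f else gi"])
    show "finite (UNIV :: bool set)" by simp
    show "closedin P (S b)" for b
    proof -
      have "S b \<subseteq> topspace P" using A by (auto simp: S_def P'_def)
      moreover have "openin P (topspace P - S b)"
        by (rule openin_isolated_points) (auto simp: S_def P'_def)
      ultimately show ?thesis by (simp add: closedin_def)
    qed
    show "continuous_map (subtopology P (S b)) Q (if b then f else gi)" for b
    proof (cases b)
      case True
      then show ?thesis using f(1) by (simp add: continuous_map_from_subtopology)
    next
      case False
      have "S b \<subseteq> g ` topspace Q" using A P'_g False by (auto simp: S_def)
      then show ?thesis using False gi_cont by (simp add: continuous_map_from_subtopology_mono)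
    qed
    show "(if b then f else gi) x = (if b' then f else gi) x"
      if "x \<in> topspace P \<inter> S b \<inter> S b'" for b b' x
      using that gi_h f(4) by (cases b; cases b') (auto simp: S_def)
    show "\<exists>b. b \<in> UNIV \<and> x \<in> S b \<and> \<phi> x = (if b then f else gi) x" if "x \<in> topspace P" for x
      using that by (intro exI[of _ "x \<in> A"]) (simp add: S_def \<phi>_def)
  qed
  moreover have gi_out: "gi x \<in> topspace Q - f ` A \<and> g (gi x) = x" if "x \<in> topspace P - A" for x
  proof -
    have "x \<in> g ` (topspace Q - f ` A)" using that A by blast
    then show ?thesis using gi_g by auto
  qed
  have AP: "A \<subseteq> topspace P" using A by blast
  have "inj_on \<phi> (topspace P)"
  proof (rule inj_onI)
    fix x y assume xy: "x \<in> topspace P" "y \<in> topspace P" "\<phi> x = \<phi> y"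
    show "x = y"
    proof (cases "x \<in> A"; cases "y \<in> A")
      assume "x \<in> A" "y \<in> A"
      then show ?thesis using xy f(2) by (simp add: \<phi>_def inj_onD)
    next
      assume "x \<in> A" "y \<notin> A"
      then show ?thesis using xy gi_out[of y] by (auto simp: \<phi>_def) (metis image_eqI)
    next
      assume "x \<notin> A" "y \<in> A"
      then show ?thesis using xy gi_out[of x] by (auto simp: \<phi>_def)
    next
      assume "x \<notin> A" "y \<notin> A"
      then have "gi x = gi y" using xy(3) by (simp add: \<phi>_def)
      moreover have "g (gi z) = z" if "z \<in> {x, y}" for z
        using gi_out[of z] that xy(1,2) \<open>x \<notin> A\<close> \<open>y \<notin> A\<close> by blast
      ultimately show ?thesis by (metis insertCI)
    qed
  qed
  moreover have "\<phi> ` topspace P = topspace Q"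
  proof
    show "\<phi> ` topspace P \<subseteq> topspace Q" using fB gi_out by (auto simp: \<phi>_def)
    show "topspace Q \<subseteq> \<phi> ` topspace P"
    proof
      fix y assume y: "y \<in> topspace Q"
      show "y \<in> \<phi> ` topspace P"
      proof (cases "y \<in> f ` A")
        case True
        then show ?thesis using AP by (force simp: \<phi>_def)
      next
        case False
        then have "g y \<notin> A" using A y by blast
        then have "\<phi> (g y) = y" using gi_g y by (simp add: \<phi>_def)
        moreover have "g y \<in> topspace P"
          using continuous_map_image_subset_topspace[OF g(1)] y by blast
        ultimately show ?thesis by (metis image_eqI)
      qed
    qed
  qed
  ultimately have "homeomorphic_map P Q \<phi>"
    using cP mQ by (intro continuous_imp_homeomorphic_map metrizable_imp_Hausdorff_space) auto
  then show ?thesis by (rule homeomorphic_map_imp_homeomorphic_space)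
qed

section \<open>A characterization of the Cantor set\<close>

definition cantor_sum :: "(nat \<Rightarrow> bool) \<Rightarrow> real" where
  "cantor_sum a = (\<Sum>n. 2 * of_bool (a n) / 3 ^ Suc n)"

lemma cantor_set_eq_range: "cantor_set = range cantor_sum"
  by (auto simp: cantor_set_def cantor_sum_def)

lemma sums_ternary: "(\<lambda>n. 2 / 3 ^ Suc n :: real) sums 1"
proof -
  have "(\<lambda>n. 2 / 3 * (1 / 3) ^ n :: real) sums (2 / 3 * (1 / (1 - 1 / 3)))"
    by (intro sums_mult geometric_sums) simp
  moreover have "(\<lambda>n. 2 / 3 * (1 / 3) ^ n :: real) = (\<lambda>n. 2 / 3 ^ Suc n)"
    by (simp add: power_divide mult.commute)
  ultimately show ?thesis by simp
qed

lemma summable_cantor_sum: "summable (\<lambda>n. 2 * of_bool (a n) / 3 ^ Suc n :: real)"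
  by (rule summable_comparison_test'[OF sums_summable[OF sums_ternary], of 0])
     (auto simp: of_bool_def)

lemma cantor_sum_Suc: "cantor_sum a = 2 * of_bool (a 0) / 3 + cantor_sum (\<lambda>n. a (Suc n)) / 3"
proof -
  have "(\<Sum>n. 2 * of_bool (a (Suc n)) / 3 ^ Suc (Suc n) :: real) = cantor_sum a - 2 * of_bool (a 0) / 3"
    using suminf_split_head[OF summable_cantor_sum[of a]] by (simp add: cantor_sum_def)
  moreover have "(\<Sum>n. 2 * of_bool (a (Suc n)) / 3 ^ Suc (Suc n) :: real)
      = (\<Sum>n. 2 * of_bool (a (Suc n)) / 3 ^ Suc n / 3)"
    by (simp add: field_simps)
  moreover have "\<dots> = cantor_sum (\<lambda>n. a (Suc n)) / 3"
    unfolding cantor_sum_def by (rule suminf_divide[OF summable_cantor_sum])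
  ultimately show ?thesis by simp
qed

lemma cantor_sum_bounds: "0 \<le> cantor_sum a" "cantor_sum a \<le> 1"
proof -
  show "0 \<le> cantor_sum a" unfolding cantor_sum_def by (rule suminf_nonneg[OF summable_cantor_sum]) simp
  have "cantor_sum a \<le> (\<Sum>n. 2 / 3 ^ Suc n)"
    unfolding cantor_sum_def
    by (rule suminf_le[OF _ summable_cantor_sum sums_summable[OF sums_ternary]]) (simp add: of_bool_def)
  then show "cantor_sum a \<le> 1" using sums_unique[OF sums_ternary] by simp
qed

text \<open>Each common leading digit can be removed at the price of a factor 1/3, and all sums lie
  in [0, 1].\<close>

lemma cantor_sum_close:
  assumes "\<And>k. k < n \<Longrightarrow> a k = b k"
  shows "\<bar>cantor_sum a - cantor_sum b\<bar> \<le> (1 / 3) ^ n"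
  using assms
proof (induction n arbitrary: a b)
  case 0
  then show ?case using cantor_sum_bounds[of a] cantor_sum_bounds[of b] by simp
next
  case (Suc n)
  have "\<bar>cantor_sum (\<lambda>n. a (Suc n)) - cantor_sum (\<lambda>n. b (Suc n))\<bar> \<le> (1 / 3) ^ n"
    using Suc.prems by (intro Suc.IH) simp
  then show ?case
    using Suc.prems[of 0] by (simp add: cantor_sum_Suc[of a] cantor_sum_Suc[of b] abs_if split: if_splits)
qed

text \<open>The first digit is visible in the value: True gives at least 2/3, False at most 1/3.
  Later digits are first digits of shifted sequences.\<close>

lemma cantor_sum_inject: "cantor_sum a = cantor_sum b \<Longrightarrow> a = b"
proof -
  assume "cantor_sum a = cantor_sum b"
  then have "a n = b n" for n
  proof (induction n arbitrary: a b)
    case 0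
    then show ?case
      using cantor_sum_Suc[of a] cantor_sum_Suc[of b] cantor_sum_bounds[of "\<lambda>n. a (Suc n)"]
        cantor_sum_bounds[of "\<lambda>n. b (Suc n)"]
      by (cases "a 0"; cases "b 0") auto
  next
    case (Suc n)
    have "a 0 = b 0"
      using Suc.prems cantor_sum_Suc[of a] cantor_sum_Suc[of b] cantor_sum_bounds[of "\<lambda>n. a (Suc n)"]
        cantor_sum_bounds[of "\<lambda>n. b (Suc n)"]
      by (cases "a 0"; cases "b 0") auto
    then have "cantor_sum (\<lambda>n. a (Suc n)) = cantor_sum (\<lambda>n. b (Suc n))"
      using Suc.prems cantor_sum_Suc[of a] cantor_sum_Suc[of b] by simp
    then show ?case by (rule Suc.IH)
  qed
  then show ?thesis by blast
qed

text \<open>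
  Each cell is split by the first clopen set of the family that cuts it; hence no member of the
  family cuts every cell of a descending chain, and the chains determine the points.
\<close>

theorem homeomorphic_cantor_set:
  fixes K :: "'a topology" and B :: "nat \<Rightarrow> 'a set"
  assumes comp: "compact_space K" and ne: "topspace K \<noteq> {}"
    and no_iso: "\<And>x. x \<in> topspace K \<Longrightarrow> \<not> openin K {x}"
    and clopen: "\<And>n. openin K (B n)" "\<And>n. closedin K (B n)"
    and sep: "\<And>x y. x \<in> topspace K \<Longrightarrow> y \<in> topspace K \<Longrightarrow> x \<noteq> y \<Longrightarrow> \<exists>n. x \<in> B n \<longleftrightarrow> y \<notin> B n"
  shows "K homeomorphic_space top_of_set cantor_set"
proof -
  define cuts where "cuts C n \<longleftrightarrow> C \<inter> B n \<noteq> {} \<and> C - B n \<noteq> {}" for C n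
  define m where "m C = (LEAST n. cuts C n)" for C
  define part where "part b C = (if b then C \<inter> B (m C) else C - B (m C))" for b C
  have part_clopen: "openin K (part b C)" "closedin K (part b C)" if "openin K C" "closedin K C" for b C
    using that clopen by (auto simp: part_def)
  have part_sub: "part b C \<subseteq> C" for b C by (auto simp: part_def)
  \<comment> \<open>A nonempty open cell has at least two points, as \<open>K\<close> has no
    isolated ones, and some member of the family separates them.\<close>
  have cuts_m: "cuts C (m C)" if C: "openin K C" "C \<noteq> {}" for C
  proof -
    obtain x where x: "x \<in> C" using C by blast
    then have xK: "x \<in> topspace K" using openin_subset[OF C(1)] by blast
    then have "C \<noteq> {x}" using no_iso C(1) by metis
    then obtain y where y: "y \<in> C" "y \<noteq> x" using x by blast
    then have "y \<in> topspace K" using openin_subset[OF C(1)] by blast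
    then obtain n where "x \<in> B n \<longleftrightarrow> y \<notin> B n" using sep[OF xK] y by metis
    then have "cuts C n" using x y by (auto simp: cuts_def)
    then show ?thesis unfolding m_def by (rule LeastI)
  qed
  have part_ne: "part b C \<noteq> {}" if "openin K C" "C \<noteq> {}" for b C
    using cuts_m[OF that] by (auto simp: part_def cuts_def)
  define cell where "cell x = rec_nat (topspace K) (\<lambda>_ C. part (x \<in> B (m C)) C)" for x
  have cell_0: "cell x 0 = topspace K" and
    cell_Suc: "cell x (Suc n) = part (x \<in> B (m (cell x n))) (cell x n)" for x n
    by (simp_all add: cell_def)
  define digit where "digit x n \<longleftrightarrow> x \<in> B (m (cell x n))" for x n
  have in_cell: "x \<in> cell x n" if "x \<in> topspace K" for x n
    by (induction n) (use that in \<open>auto simp: cell_0 cell_Suc part_def\<close>)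
  have cell_clopen: "openin K (cell x n) \<and> closedin K (cell x n)" for x n
    by (induction n) (auto simp: cell_0 cell_Suc part_clopen)
  have same_cell: "cell y n = cell x n \<and> (\<forall>k<n. digit y k = digit x k)" if "y \<in> cell x n" for x y n
    using that
  proof (induction n)
    case (Suc n)
    then have "y \<in> cell x n" using part_sub cell_Suc by blast
    then have IH: "cell y n = cell x n" "\<forall>k<n. digit y k = digit x k" using Suc.IH by auto
    have "digit y n = digit x n"
      using Suc.prems IH(1) by (auto simp: cell_Suc part_def digit_def split: if_splits)
    then show ?case using IH by (auto simp: cell_Suc digit_def less_Suc_eq)
  qed (simp add: cell_0)
  have cell_eq: "cell y n = cell x n" if "\<And>k. k < n \<Longrightarrow> digit y k = digit x k" for x y n
    using that
  proof (induction n)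
    case (Suc n)
    then have "cell y n = cell x n" "digit y n = digit x n" by auto
    then show ?case by (simp add: cell_Suc digit_def)
  qed (simp add: cell_0)
  have digits_inj: "x = y" if xy: "x \<in> topspace K" "y \<in> topspace K" "\<And>k. digit y k = digit x k" for x y
  proof (rule ccontr)
    assume "x \<noteq> y"
    then obtain N where N: "x \<in> B N \<longleftrightarrow> y \<notin> B N" using sep xy by metis
    have "y \<in> cell x n" for n using in_cell[OF xy(2)] cell_eq xy(3) by blast
    then have cutN: "cuts (cell x n) N" for n using in_cell[OF xy(1)] N unfolding cuts_def by blast
    have cuts_mx: "cuts (cell x n) (m (cell x n))" for n
      using cuts_m cell_clopen in_cell[OF xy(1)] by blast
    \<comment> \<open>What cuts the smaller cell cuts the larger one, so the least cutting index
      cannot drop; the index just used no longer cuts, so it grows.\<close>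
    have "m (cell x n) < m (cell x (Suc n))" for n
    proof -
      have "cuts (cell x n) (m (cell x (Suc n)))"
        using cuts_mx[of "Suc n"] part_sub unfolding cuts_def cell_Suc by blast
      then have "m (cell x n) \<le> m (cell x (Suc n))"
        unfolding m_def[of "cell x n"] by (rule Least_le)
      moreover have "\<not> cuts (cell x (Suc n)) (m (cell x n))"
        by (auto simp: cuts_def cell_Suc part_def)
      then have "m (cell x n) \<noteq> m (cell x (Suc n))" using cuts_mx[of "Suc n"] by metis
      ultimately show ?thesis by simp
    qed
    then have "strict_mono (\<lambda>n. m (cell x n))" by (simp add: strict_mono_Suc_iff)
    then have "Suc N \<le> m (cell x (Suc N))" by (rule strict_mono_imp_increasing)
    also have "\<dots> \<le> N" unfolding m_def by (rule Least_le) (rule cutN)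
    finally show False by simp
  qed
  have digits_surj: "\<exists>x\<in>topspace K. \<forall>n. digit x n = a n" for a
  proof -
    define D where "D = rec_nat (topspace K) (\<lambda>n C. part (a n) C)"
    have D0: "D 0 = topspace K" and DS: "D (Suc n) = part (a n) (D n)" for n
      by (simp_all add: D_def)
    have Dc: "openin K (D n) \<and> closedin K (D n) \<and> D n \<noteq> {}" for n
      by (induction n) (use ne in \<open>auto simp: D0 DS part_clopen part_ne\<close>)
    have "D j \<subseteq> D i" if "i \<le> j" for i j
      by (rule lift_Suc_antimono_le[OF _ that]) (simp add: DS part_sub)
    then have "antimono_on UNIV D" by (simp add: monotone_on_def)
    then have "\<Inter>(range D) \<noteq> {}"
      by (intro compact_space_imp_nest[OF comp]) (simp_all add: Dc)
    then obtain x where x: "\<And>n. x \<in> D n" by auto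
    have "cell x n = D n" for n
    proof (induction n)
      case (Suc n)
      then show ?case using x[of "Suc n"] by (auto simp: cell_Suc DS part_def split: if_splits)
    qed (simp add: cell_0 D0)
    then have "digit x n = a n" for n
      using x[of "Suc n"] by (auto simp: DS digit_def part_def split: if_splits)
    then show ?thesis using x[of 0] D0 by blast
  qed
  define \<phi> where "\<phi> x = cantor_sum (digit x)" for x
  have "continuous_map K Met_TC.mtopology \<phi>"
    unfolding Met_TC.continuous_map_to_metric
  proof (intro ballI allI impI)
    fix x and \<epsilon> :: real assume x: "x \<in> topspace K" and "0 < \<epsilon>"
    then obtain n where n: "(1 / 3) ^ n < \<epsilon>" using real_arch_pow_inv[of \<epsilon> "1 / 3"] by auto
    have "dist (\<phi> x) (\<phi> y) < \<epsilon>" if "y \<in> cell x n" for y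
    proof -
      have "\<bar>cantor_sum (digit x) - cantor_sum (digit y)\<bar> \<le> (1 / 3) ^ n"
        using same_cell[OF that] by (intro cantor_sum_close) simp
      then show ?thesis using n by (simp add: \<phi>_def dist_real_def)
    qed
    then show "\<exists>U. openin K U \<and> x \<in> U \<and> (\<forall>y\<in>U. \<phi> y \<in> Met_TC.mball (\<phi> x) \<epsilon>)"
      using cell_clopen in_cell[OF x] by (intro exI[of _ "cell x n"]) auto
  qed
  then have cont: "continuous_map K euclideanreal \<phi>" by simp
  have "\<phi> ` topspace K = cantor_set"
  proof
    show "cantor_set \<subseteq> \<phi> ` topspace K"
    proof
      fix v assume "v \<in> cantor_set"
      then obtain a where a: "v = cantor_sum a" by (auto simp: cantor_set_eq_range)
      obtain x where "x \<in> topspace K" "\<forall>n. digit x n = a n" using digits_surj by blast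
      moreover from this have "digit x = a" by blast
      ultimately show "v \<in> \<phi> ` topspace K" using a by (auto simp: \<phi>_def)
    qed
  qed (auto simp: \<phi>_def cantor_set_eq_range)
  moreover have "inj_on \<phi> (topspace K)"
    by (intro inj_onI digits_inj) (auto simp: \<phi>_def dest!: cantor_sum_inject)
  ultimately have "homeomorphic_map K (top_of_set cantor_set) \<phi>"
    using cont comp
    by (intro continuous_imp_homeomorphic_map)
       (auto simp: continuous_map_in_subtopology Hausdorff_space_subtopology)
  then show ?thesis by (rule homeomorphic_map_imp_homeomorphic_space)
qed

section \<open>Words of subshifts\<close>

definition factor :: "(int \<Rightarrow> int) \<Rightarrow> int \<Rightarrow> nat \<Rightarrow> int list" where
  "factor x i n = map (\<lambda>k. x (i + int k)) [0..<n]"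

lemma length_factor [simp]: "length (factor x i n) = n"
  by (simp add: factor_def)

lemma nth_factor [simp]: "k < n \<Longrightarrow> factor x i n ! k = x (i + int k)"
  by (simp add: factor_def)

lemma factor_eq_iff: "factor x i n = factor y j n \<longleftrightarrow> (\<forall>k<n. x (i + int k) = y (j + int k))"
  by (auto simp: list_eq_iff_nth_eq)

lemma factor_Suc: "factor x i (Suc n) = factor x i n @ [x (i + int n)]"
  by (simp add: factor_def)

lemma factor_Cons: "factor x i (Suc n) = x i # factor x (i + 1) n"
  by (rule nth_equalityI) (auto simp: nth_Cons algebra_simps split: nat.splits)

lemma butlast_factor: "butlast (factor x i (Suc n)) = factor x i n"
  by (simp add: factor_Suc)

lemma tl_factor: "tl (factor x i (Suc n)) = factor x (i + 1) n"
  by (simp add: factor_Cons)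

lemma occurs_in_iff_factor: "occurs_in w x \<longleftrightarrow> (\<exists>i. w = factor x i (length w))"
  by (simp add: occurs_in_def factor_def)

lemma lang_eq_factor: "lang n X = {factor x i n | x i. x \<in> X}"
proof -
  have "length w = n \<and> (\<exists>x\<in>X. occurs_in w x) \<longleftrightarrow> (\<exists>x i. w = factor x i n \<and> x \<in> X)" for w
    by (metis length_factor occurs_in_iff_factor)
  then show ?thesis unfolding lang_def by simp
qed

lemma factor_in_lang: "x \<in> X \<Longrightarrow> factor x i n \<in> lang n X"
  by (auto simp: lang_eq_factor)

lemma length_lang: "w \<in> lang n X \<Longrightarrow> length w = n"
  by (simp add: lang_def)

lemma lang_mono: "X \<subseteq> Z \<Longrightarrow> lang n X \<subseteq> lang n Z"
  by (force simp: lang_eq_factor)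

lemma butlast_lang: "butlast ` lang (Suc n) X = lang n X"
proof
  show "lang n X \<subseteq> butlast ` lang (Suc n) X"
    by (force simp: lang_eq_factor butlast_factor image_iff)
  show "butlast ` lang (Suc n) X \<subseteq> lang n X"
    by (force simp: lang_eq_factor butlast_factor)
qed

lemma tl_lang: "tl ` lang (Suc n) X = lang n X"
proof
  show "lang n X \<subseteq> tl ` lang (Suc n) X"
  proof
    fix w assume "w \<in> lang n X"
    then obtain x i where "x \<in> X" "w = factor x i n" by (auto simp: lang_eq_factor)
    then have "w = tl (factor x (i - 1) (Suc n))" by (simp add: tl_factor)
    then show "w \<in> tl ` lang (Suc n) X" using \<open>x \<in> X\<close> factor_in_lang by blast
  qed
  show "tl ` lang (Suc n) X \<subseteq> lang n X"
    by (force simp: lang_eq_factor tl_factor)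
qed

lemma take_factor: "k \<le> n \<Longrightarrow> take k (factor x i n) = factor x i k"
  by (rule nth_equalityI) auto

lemma drop_factor: "drop k (factor x i n) = factor x (i + int k) (n - k)"
  by (rule nth_equalityI) (auto simp: algebra_simps)

lemma take_in_lang: "w \<in> lang n X \<Longrightarrow> k \<le> n \<Longrightarrow> take k w \<in> lang k X"
  by (force simp: lang_eq_factor take_factor)

lemma drop_in_lang: "w \<in> lang n X \<Longrightarrow> k \<le> n \<Longrightarrow> drop (n - k) w \<in> lang k X"
  by (force simp: lang_eq_factor drop_factor)

lemma lang_eq_mono:
  assumes "lang n X = lang n Z" "k \<le> n"
  shows "lang k X = lang k Z"
  using assms(2,1)
proof (induction n rule: dec_induct)
  case (step n)
  then show ?case by (metis butlast_lang)
qed simp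

lemma lang_translate: "w \<in> lang n X \<Longrightarrow> subshift X \<Longrightarrow> \<exists>x\<in>X. factor x i n = w"
proof -
  assume "w \<in> lang n X" and X: "subshift X"
  then obtain x j where x: "x \<in> X" "w = factor x j n"
    by (auto simp: lang_eq_factor)
  have "factor (\<lambda>k. x (k + (j - i))) i n = w"
    by (simp add: x factor_def algebra_simps)
  then show ?thesis
    using subshift_translate[OF X x(1)] by blast
qed

lemma subshift_nonempty: "subshift X \<Longrightarrow> X \<noteq> {}"
  and subshift_compact: "subshift X \<Longrightarrow> compact X"
  by (auto simp: subshift_def)

lemma lang_nonempty: "subshift X \<Longrightarrow> lang n X \<noteq> {}"
  using subshift_nonempty factor_in_lang by blast

lemma subshift_eqI:
  assumes "subshift X" "subshift Z" "\<And>n. lang n X = lang n Z"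
  shows "X = Z"
  using subshift_subset_if_lang_eq assms by (metis subset_antisym)

lemma continuous_on_eval: "continuous_on S (\<lambda>x :: int \<Rightarrow> int. x i)"
  by (rule continuous_on_subset[OF continuous_on_product_coordinates]) simp

text \<open>The letters at position 0 form a compact subset of a discrete space, and shift
  invariance brings every letter to position 0.\<close>

lemma finite_alphabet:
  assumes "subshift X"
  shows "finite {x i | x i. x \<in> X}"
proof -
  have "compact ((\<lambda>x. x 0) ` X)"
    by (intro compact_continuous_image continuous_on_eval subshift_compact assms)
  then obtain C where C: "C \<subseteq> UNIV" "finite C" "(\<lambda>x. x 0) ` X \<subseteq> (\<Union>c\<in>C. {c})"
    by (rule compactE_image[of _ UNIV "\<lambda>c. {c}"]) (simp_all add: open_discrete)
  then have "finite ((\<lambda>x. x 0) ` X)" by (simp add: finite_subset)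
  moreover have "{x i | x i. x \<in> X} \<subseteq> (\<lambda>x. x 0) ` X"
  proof clarify
    fix x i assume "x \<in> X"
    then have "(\<lambda>k. x (k + i)) \<in> X" using assms subshift_translate by blast
    then show "x i \<in> (\<lambda>x. x 0) ` X" by (intro image_eqI[of _ _ "\<lambda>k. x (k + i)"]) simp_all
  qed
  ultimately show ?thesis by (rule rev_finite_subset)
qed

lemma finite_lang:
  assumes "subshift X"
  shows "finite (lang n X)"
proof (rule finite_subset)
  show "lang n X \<subseteq> {w. set w \<subseteq> {x i | x i. x \<in> X} \<and> length w = n}"
    unfolding lang_eq_factor factor_def by force
  show "finite {w. set w \<subseteq> {x i | x i. x \<in> X} \<and> length w = n}"
    using finite_alphabet[OF assms] by (rule finite_lists_length_eq)
qed

lemma open_factor: "open {x. factor x i n \<in> W}"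
proof -
  have "{x. factor x i n \<in> W} = (\<Union>w\<in>{w\<in>W. length w = n}. \<Inter>k<n. (\<lambda>x. x (i + int k)) -` {w ! k})"
  proof (intro equalityI subsetI)
    fix x assume "x \<in> {x. factor x i n \<in> W}"
    then show "x \<in> (\<Union>w\<in>{w\<in>W. length w = n}. \<Inter>k<n. (\<lambda>x. x (i + int k)) -` {w ! k})"
      by (intro UN_I[of "factor x i n"]) simp_all
  next
    fix x assume "x \<in> (\<Union>w\<in>{w\<in>W. length w = n}. \<Inter>k<n. (\<lambda>x. x (i + int k)) -` {w ! k})"
    then obtain w where w: "w \<in> W" "length w = n" "\<And>k. k < n \<Longrightarrow> x (i + int k) = w ! k"
      by auto
    then have "factor x i n = w" by (intro nth_equalityI) auto
    then show "x \<in> {x. factor x i n \<in> W}" using w by simp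
  qed
  moreover have "open ((\<lambda>x :: int \<Rightarrow> int. x j) -` {c})" for j c
    by (intro open_vimage continuous_on_eval open_discrete)
  ultimately show ?thesis by (auto intro!: open_UN open_INT)
qed

lemma closed_factor: "closed {x. factor x i n \<in> W}"
proof -
  have "- {x. factor x i n \<in> W} = {x. factor x i n \<in> - W}" by auto
  then show ?thesis using open_factor by (metis closed_def)
qed

section \<open>Shifts of finite type presented by words of a fixed length\<close>

text \<open>\<open>W\<close> lists allowed words, in contrast to the forbidden words of
  \<open>shift_of_finite_type\<close>; they serve directly as arcs of a Rauzy graph.\<close>

definition sft :: "nat \<Rightarrow> int list set \<Rightarrow> (int \<Rightarrow> int) set" where
  "sft n W = {x. \<forall>i. factor x i n \<in> W}"

lemma sft_iff: "x \<in> sft n W \<longleftrightarrow> (\<forall>i. factor x i n \<in> W)"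
  by (simp add: sft_def)

lemma subset_sft_lang: "X \<subseteq> sft n (lang n X)"
  by (auto simp: sft_iff factor_in_lang)

lemma closed_sft: "closed (sft n W)"
proof -
  have "sft n W = (\<Inter>i. {x. factor x i n \<in> W})" by (auto simp: sft_iff)
  then show ?thesis using closed_factor by (auto intro!: closed_INT)
qed

lemma compact_sequences: "finite A \<Longrightarrow> compact {x :: int \<Rightarrow> int. range x \<subseteq> A}"
proof -
  assume "finite A"
  then have "compactin (product_topology (\<lambda>i::int. euclidean) UNIV) (Pi\<^sub>E UNIV (\<lambda>_. A))"
    unfolding compactin_PiE by (simp add: finite_imp_compact)
  moreover have "Pi\<^sub>E UNIV (\<lambda>_. A) = {x :: int \<Rightarrow> int. range x \<subseteq> A}" by (auto simp: PiE_def)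
  ultimately show ?thesis by (simp add: euclidean_product_topology)
qed

text \<open>A window of positive length confines all entries to the finitely many letters of
  \<open>W\<close>; a window of length 0 says nothing about letters, hence the successor.\<close>

lemma compact_sft:
  assumes "finite W"
  shows "compact (sft (Suc m) W)"
proof -
  have "sft (Suc m) W \<subseteq> {x. range x \<subseteq> (\<Union>w\<in>W. set w)}"
  proof clarsimp
    fix x i assume "x \<in> sft (Suc m) W"
    then have "factor x i (Suc m) \<in> W" by (simp add: sft_iff)
    moreover have "x i \<in> set (factor x i (Suc m))" by (simp add: factor_Cons)
    ultimately show "\<exists>w\<in>W. x i \<in> set w" by blast
  qed
  then have "sft (Suc m) W = {x. range x \<subseteq> (\<Union>w\<in>W. set w)} \<inter> sft (Suc m) W" by blast
  moreover have "compact {x :: int \<Rightarrow> int. range x \<subseteq> (\<Union>w\<in>W. set w)}"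
    by (rule compact_sequences) (use assms in simp)
  ultimately show ?thesis
    using compact_Int_closed[OF _ closed_sft] by metis
qed

lemma shift_image_sft: "shift ` sft n W = sft n W"
proof -
  have 1: "factor (shift x) i n = factor x (i + 1) n" for x i
    by (simp add: factor_def shift_def algebra_simps)
  have 2: "factor (\<lambda>k. x (k - 1)) i n = factor x (i - 1) n" for x i
    by (simp add: factor_def algebra_simps)
  have "shift x \<in> sft n W" if "x \<in> sft n W" for x
    using that by (simp add: sft_iff 1)
  moreover have "x \<in> shift ` sft n W" if "x \<in> sft n W" for x
  proof (rule image_eqI)
    show "x = shift (\<lambda>k. x (k - 1))" by (simp add: shift_def)
    show "(\<lambda>k. x (k - 1)) \<in> sft n W" using that by (simp add: sft_iff 2)
  qed
  ultimately show ?thesis by blast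
qed

text \<open>A two-sided infinite walk in the graph of overlapping words spells a sequence: the
  letter at place \<open>j\<close> of \<open>g k\<close> becomes the head \<open>j\<close> steps
  later.\<close>

lemma factor_path:
  assumes len: "\<And>k. length (g k) = Suc m" and step: "\<And>k. tl (g k) = butlast (g (k + 1))"
  shows "factor (\<lambda>k. hd (g k)) k (Suc m) = g k"
proof (rule nth_equalityI)
  show "length (factor (\<lambda>k. hd (g k)) k (Suc m)) = length (g k)" by (simp add: len)
  have "g k ! j = hd (g (k + int j))" if "j \<le> m" for j
    using that
  proof (induction j arbitrary: k)
    case 0
    then show ?case by (metis add.right_neutral hd_conv_nth int_ops(1) len length_0_conv nat.distinct(1))
  next
    case (Suc j)
    have "g k ! Suc j = tl (g k) ! j" using Suc.prems by (simp add: nth_tl len)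
    also have "\<dots> = g (k + 1) ! j" using Suc.prems by (simp add: step nth_butlast len)
    also have "\<dots> = hd (g (k + 1 + int j))" using Suc by simp
    finally show ?case by (simp add: algebra_simps)
  qed
  then show "factor (\<lambda>k. hd (g k)) k (Suc m) ! j = g k ! j"
    if "j < length (factor (\<lambda>k. hd (g k)) k (Suc m))" for j
    using that by simp
qed

text \<open>With \<open>w\<close> as an arc from \<open>butlast w\<close> to \<open>tl w\<close>,
  this is a finite nonempty graph without sources and sinks. The vertices are words of length
  \<open>m\<close>.\<close>

definition extendable :: "nat \<Rightarrow> int list set \<Rightarrow> bool" where
  "extendable m W \<longleftrightarrow> finite W \<and> W \<noteq> {} \<and> (\<forall>w\<in>W. length w = Suc m) \<and> butlast ` W = tl ` W"

lemma extendable_lang: "subshift X \<Longrightarrow> extendable m (lang (Suc m) X)"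
  by (simp add: extendable_def finite_lang lang_nonempty length_lang butlast_lang tl_lang)

text \<open>Without sources and sinks, every arc lies on a two-sided infinite walk, obtained by
  iterating chosen successors and predecessors; the walk spells a point containing the given
  word.\<close>

lemma lang_sft:
  assumes "extendable m W"
  shows "lang (Suc m) (sft (Suc m) W) = W"
proof
  show "lang (Suc m) (sft (Suc m) W) \<subseteq> W" by (auto simp: lang_eq_factor sft_iff)
  show "W \<subseteq> lang (Suc m) (sft (Suc m) W)"
  proof
    fix w assume w: "w \<in> W"
    have "\<forall>v\<in>W. \<exists>s\<in>W. butlast s = tl v" "\<forall>v\<in>W. \<exists>s\<in>W. tl s = butlast v"
      using assms unfolding extendable_def by (metis image_iff)+
    then obtain succ pred where succ: "\<And>v. v \<in> W \<Longrightarrow> succ v \<in> W \<and> butlast (succ v) = tl v"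
      and pred: "\<And>v. v \<in> W \<Longrightarrow> pred v \<in> W \<and> tl (pred v) = butlast v" by metis
    define g where "g k = (if k \<ge> 0 then (succ ^^ nat k) w else (pred ^^ nat (- k)) w)" for k :: int
    have "(succ ^^ n) w \<in> W" "(pred ^^ n) w \<in> W" for n
      by (induction n) (use w succ pred in auto)
    then have gW: "g k \<in> W" for k by (simp add: g_def)
    have "tl (g k) = butlast (g (k + 1))" for k
    proof (cases "k \<ge> 0")
      case True
      then have "nat (k + 1) = Suc (nat k)" by simp
      then have "g (k + 1) = succ (g k)" using True by (simp add: g_def)
      then show ?thesis using succ gW by metis
    next
      case False
      then have "nat (- k) = Suc (nat (- (k + 1)))" by simp
      then have "g k = pred (g (k + 1))"
        using False by (cases "k = - 1") (simp_all add: g_def)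
      then show ?thesis using pred gW by metis
    qed
    then have path: "factor (\<lambda>k. hd (g k)) k (Suc m) = g k" for k
      by (intro factor_path) (use gW assms in \<open>auto simp: extendable_def\<close>)
    then have "(\<lambda>k. hd (g k)) \<in> sft (Suc m) W" by (simp add: sft_iff gW)
    moreover have "factor (\<lambda>k. hd (g k)) 0 (Suc m) = w" by (simp only: path) (simp add: g_def)
    ultimately show "w \<in> lang (Suc m) (sft (Suc m) W)" by (metis factor_in_lang)
  qed
qed

lemma subshift_sft:
  assumes "extendable m W"
  shows "subshift (sft (Suc m) W)"
proof -
  have "W \<noteq> {}" "finite W" using assms by (auto simp: extendable_def)
  then have "sft (Suc m) W \<noteq> {}" using lang_sft[OF assms] by (auto simp: lang_eq_factor)
  then show ?thesis
    using compact_sft[OF \<open>finite W\<close>] shift_image_sft by (simp add: subshift_def)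
qed

text \<open>A window of length \<open>m + 1\<close> starting before \<open>k\<close> ends before
  \<open>k + m\<close>, inside the block where both points agree, so it is a window of
  \<open>x\<close>. All other windows are windows of \<open>y\<close>.\<close>

lemma glue_sft:
  assumes x: "x \<in> sft (Suc m) W" and y: "y \<in> sft (Suc m) W" and eq: "factor x k m = factor y k m"
  shows "(\<lambda>i. if i < k then x i else y i) \<in> sft (Suc m) W" (is "?z \<in> _")
  unfolding sft_iff
proof
  fix i
  have "factor ?z i (Suc m) = (if i < k then factor x i (Suc m) else factor y i (Suc m))"
  proof (cases "i < k")
    case True
    have "?z (i + int j) = x (i + int j)" if "j < Suc m" for j
    proof (cases "i + int j < k")
      case False
      define l where "l = nat (i + int j - k)"
      have l: "i + int j = k + int l" "l < m" using False True that by (auto simp: l_def)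
      then have "x (k + int l) = y (k + int l)" using eq by (simp add: factor_eq_iff)
      then show ?thesis using False l by simp
    qed simp
    then show ?thesis using True by (simp add: factor_eq_iff)
  next
    case False
    then show ?thesis by (simp add: factor_eq_iff)
  qed
  then show "factor ?z i (Suc m) \<in> W" using x y by (simp add: sft_iff)
qed

section \<open>Isolated subshifts\<close>

text \<open>This is isolation in the space of all subshifts, over any finite alphabet, written
  without the metric.\<close>

definition lang_determined :: "(int \<Rightarrow> int) set \<Rightarrow> bool" where
  "lang_determined X \<longleftrightarrow> (\<exists>n. \<forall>Z. subshift Z \<and> lang n Z = lang n X \<longrightarrow> Z = X)"

text \<open>Only words of one length are consulted; which combinations \<open>a # w @ [b]\<close>
  occur is information of the next length and stays open here.\<close>

definition bispecial_free :: "int list set \<Rightarrow> bool" where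
  "bispecial_free W \<longleftrightarrow>
     (\<forall>w a a' b b'. a # w \<in> W \<and> a' # w \<in> W \<and> w @ [b] \<in> W \<and> w @ [b'] \<in> W \<longrightarrow> a = a' \<or> b = b')"

lemma bispecial_freeD:
  "bispecial_free W \<Longrightarrow> a # w \<in> W \<Longrightarrow> a' # w \<in> W \<Longrightarrow> w @ [b] \<in> W \<Longrightarrow> w @ [b'] \<in> W \<Longrightarrow> a = a' \<or> b = b'"
  unfolding bispecial_free_def by blast

text \<open>For \<open>a # w @ [b]\<close> in \<open>U\<close>, the set \<open>V\<close> must
  contain some \<open>a # w @ [b1]\<close> and some \<open>a1 # w @ [b]\<close>. Since
  \<open>w\<close> is not bispecial, \<open>a = a1\<close> or \<open>b = b1\<close>, and one of the
  two is the given word.\<close>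

lemma bispecial_free_extension_subset:
  assumes W: "bispecial_free W"
    and U: "butlast ` U = W" "tl ` U = W" "\<And>u. u \<in> U \<Longrightarrow> length u \<ge> 2"
    and V: "butlast ` V = W" "tl ` V = W" "\<And>u. u \<in> V \<Longrightarrow> length u \<ge> 2"
  shows "U \<subseteq> V"
proof
  fix u assume u: "u \<in> U"
  then have "length u \<ge> 2" using U by blast
  then have "u = hd u # tl u" "tl u \<noteq> []" by (cases u; force)+
  then obtain a t where at: "u = a # t" "t \<noteq> []" by metis
  then obtain w b where wb: "t = w @ [b]" by (metis append_butlast_last_id)
  have ueq: "u = a # w @ [b]" using at wb by simp
  have aw: "a # w \<in> W" using u U(1) ueq by (metis butlast_snoc append_Cons image_eqI)
  have wb: "w @ [b] \<in> W" using u U(2) ueq by (metis list.sel(3) image_eqI)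
  obtain v where v: "v \<in> V" "butlast v = a # w" using aw V(1) by (metis imageE)
  define b1 where "b1 = last v"
  have v_eq: "v = a # w @ [b1]" using v by (metis append_Cons append_butlast_last_id b1_def butlast.simps(1) list.distinct(1))
  obtain v' where v': "v' \<in> V" "tl v' = w @ [b]" using wb V(2) by (metis imageE)
  define a1 where "a1 = hd v'"
  have v'_eq: "v' = a1 # w @ [b]" using v' by (metis a1_def append_is_Nil_conv list.collapse list.sel(2) not_Cons_self2)
  have "w @ [b1] \<in> W" using v(1) V(2) v_eq by (metis list.sel(3) image_eqI)
  moreover have "a1 # w \<in> W" using v'(1) V(1) v'_eq by (metis butlast_snoc append_Cons image_eqI)
  ultimately have "a = a1 \<or> b = b1" using bispecial_freeD[OF W aw _ wb] by blast
  then show "u \<in> V" using v v' v_eq v'_eq ueq by auto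
qed

lemma bispecial_free_extension_unique:
  assumes "bispecial_free W"
    and "butlast ` U = W" "tl ` U = W" "\<And>u. u \<in> U \<Longrightarrow> length u \<ge> 2"
    and "butlast ` V = W" "tl ` V = W" "\<And>u. u \<in> V \<Longrightarrow> length u \<ge> 2"
  shows "U = V"
  using bispecial_free_extension_subset[OF assms(1-7)]
    bispecial_free_extension_subset[OF assms(1) assms(5-7) assms(2-4)] by blast

lemma lang_determinedI:
  assumes X: "subshift X" and bf: "\<And>n. n \<ge> N \<Longrightarrow> bispecial_free (lang (Suc n) X)"
  shows "lang_determined X"
  unfolding lang_determined_def
proof (intro exI allI impI)
  fix Z assume Z: "subshift Z \<and> lang (Suc N) Z = lang (Suc N) X"
  have step: "lang (Suc n) Z = lang (Suc n) X" if "n \<ge> N" for n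
    using that
  proof (induction n rule: dec_induct)
    case base
    then show ?case using Z by simp
  next
    case (step n)
    show ?case
    proof (rule bispecial_free_extension_unique[OF bf[of n]])
      show "butlast ` lang (Suc (Suc n)) Z = lang (Suc n) X" "tl ` lang (Suc (Suc n)) Z = lang (Suc n) X"
        using step by (simp_all add: butlast_lang tl_lang)
    qed (use step in \<open>simp_all add: butlast_lang tl_lang length_lang\<close>)
  qed
  have "lang n Z = lang n X" for n
    using lang_eq_mono[OF step[of "max n N"], of n] by simp
  then show "Z = X" using subshift_eqI Z X by blast
qed

subsection \<open>Density of the isolated subshifts\<close>

text \<open>
  At a word with left extensions \<open>A\<close> and right extensions \<open>B\<close>, the two-sided extensions can be
  restricted to \<open>{a\<^sub>0} \<times> (B - {b\<^sub>0}) \<union> (A - {a\<^sub>0}) \<times> {b\<^sub>0}\<close> when both \<open>A\<close> and \<open>B\<close> have at least two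
  elements. Each bispecial word thus lowers the growth of the number of words.
\<close>

lemma sparse_extension:
  assumes W: "extendable m W"
  obtains W' where "extendable (Suc m) W'" "butlast ` W' = W" "tl ` W' = W"
    "card W' + card (butlast ` W) \<le> 2 * card W"
    "\<not> bispecial_free W \<Longrightarrow> card W' + card (butlast ` W) < 2 * card W"
proof -
  define V where "V = butlast ` W"
  have finW: "finite W" and neW: "W \<noteq> {}" and len: "\<And>w. w \<in> W \<Longrightarrow> length w = Suc m"
    and VW: "V = tl ` W" using W by (auto simp: extendable_def V_def)
  have finV: "finite V" using finW V_def by simp
  have nn: "w \<in> W \<Longrightarrow> w \<noteq> []" for w using len by fastforce
  have "\<exists>b. w @ [b] \<in> W" if "w \<in> V" for w
    using that nn unfolding V_def by (metis append_butlast_last_id imageE)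
  then obtain b0 where b0: "\<And>w. w \<in> V \<Longrightarrow> w @ [b0 w] \<in> W" by metis
  have "\<exists>a. a # w \<in> W" if "w \<in> V" for w
    using that nn unfolding VW by (metis list.collapse imageE)
  then obtain a0 where a0: "\<And>w. w \<in> V \<Longrightarrow> a0 w # w \<in> W" by metis
  define bis where "bis w \<longleftrightarrow>
    (\<exists>a a' b b'. a # w \<in> W \<and> a' # w \<in> W \<and> w @ [b] \<in> W \<and> w @ [b'] \<in> W \<and> a \<noteq> a' \<and> b \<noteq> b')" for w
  \<comment> \<open>At each \<open>w\<close>, \<open>S1\<close> pairs the chosen left letter with
    all other right letters, \<open>S2\<close> the chosen right letter with all other left letters.
    The pair of both chosen letters (\<open>S0\<close>) can be spared at a bispecial word, where
    each one-sided extension already occurs in \<open>S1\<close> or \<open>S2\<close>; at other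
    words the three sets give all pairs.\<close>
  define R where "R = W - (\<lambda>w. w @ [b0 w]) ` V"
  define L where "L = W - (\<lambda>w. a0 w # w) ` V"
  define S0 where "S0 = (\<lambda>w. a0 w # w @ [b0 w]) ` {w \<in> V. \<not> bis w}"
  define S1 where "S1 = (\<lambda>u. a0 (butlast u) # u) ` R"
  define S2 where "S2 = (\<lambda>u. u @ [b0 (tl u)]) ` L"
  define W' where "W' = S0 \<union> S1 \<union> S2"
  have cR: "card R = card W - card V"
    unfolding R_def using b0 finV by (subst card_Diff_subset) (auto simp: card_image inj_on_def)
  have cL: "card L = card W - card V"
    unfolding L_def using a0 finV by (subst card_Diff_subset) (auto simp: card_image inj_on_def)
  have cVW: "card V \<le> card W" unfolding V_def using finW by (rule card_image_le)
  have finR: "finite R" "finite L" using finW by (auto simp: R_def L_def)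
  have "card W' \<le> card S0 + card S1 + card S2"
    unfolding W'_def by (meson add_le_mono card_Un_le order.trans order_refl)
  also have "\<dots> \<le> card {w \<in> V. \<not> bis w} + card R + card L"
    unfolding S0_def S1_def S2_def using finR finV by (intro add_mono card_image_le) auto
  \<comment> \<open>With \<open>A\<close> and \<open>B\<close> as above, \<open>w\<close>
    contributes \<open>|A| - 1 + |B| - 1\<close>, plus 1 if it is not bispecial. Both
    \<open>|A|\<close> and \<open>|B|\<close> sum to \<open>card W\<close> over
    \<open>V\<close>.\<close>
  finally have card1: "card W' \<le> card {w \<in> V. \<not> bis w} + 2 * (card W - card V)"
    by (simp add: cR cL)
  have "card {w \<in> V. \<not> bis w} \<le> card V" using finV by (intro card_mono) auto
  then have c1: "card W' + card V \<le> 2 * card W" using card1 cVW by linarith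
  have c2: "card W' + card V < 2 * card W" if nbf: "\<not> bispecial_free W"
  proof -
    obtain w where w: "bis w" using nbf unfolding bispecial_free_def bis_def by blast
    then have "w \<in> V" unfolding bis_def V_def by (metis butlast_snoc image_eqI)
    then have "{w \<in> V. \<not> bis w} \<subset> V" using w by blast
    then have "card {w \<in> V. \<not> bis w} < card V" using finV by (rule psubset_card_mono[rotated])
    then show ?thesis using card1 cVW by linarith
  qed
  have blV: "butlast u \<in> V" "tl u \<in> V" if "u \<in> W" for u using that VW V_def by auto
  have butlast_sub: "butlast u \<in> W" if u: "u \<in> W'" for u
  proof -
    consider w where "w \<in> V" "u = a0 w # w @ [b0 w]" | v where "v \<in> R" "u = a0 (butlast v) # v"
      | v where "v \<in> L" "u = v @ [b0 (tl v)]"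
      using u unfolding W'_def S0_def S1_def S2_def by blast
    then show ?thesis
    proof cases
      case 1
      then have "butlast u = a0 w # w" by (metis append_Cons butlast_snoc)
      then show ?thesis using 1 a0 by simp
    next
      case 2
      then have "v \<in> W" "v \<noteq> []" using nn by (auto simp: R_def)
      then show ?thesis using 2 a0 blV by simp
    next
      case 3
      then show ?thesis by (simp add: L_def)
    qed
  qed
  have tl_sub: "tl u \<in> W" if u: "u \<in> W'" for u
  proof -
    consider w where "w \<in> V" "u = a0 w # w @ [b0 w]" | v where "v \<in> R" "u = a0 (butlast v) # v"
      | v where "v \<in> L" "u = v @ [b0 (tl v)]"
      using u unfolding W'_def S0_def S1_def S2_def by blast
    then show ?thesis
    proof cases
      case 1
      then show ?thesis using b0 by simp
    next
      case 2
      then show ?thesis by (simp add: R_def)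
    next
      case 3
      then have "v \<in> W" "v \<noteq> []" using nn by (auto simp: L_def)
      then show ?thesis using 3 b0 blV by simp
    qed
  qed
  have bl: "butlast ` W' = W"
  proof
    show "W \<subseteq> butlast ` W'"
    proof
      fix v assume v: "v \<in> W"
      define w where "w = tl v"
      have w: "w \<in> V" "v = hd v # w" using blV v nn w_def by auto
      show "v \<in> butlast ` W'"
      proof (cases "v \<in> L")
        case True
        then have "v @ [b0 (tl v)] \<in> W'" by (simp add: W'_def S2_def)
        then show ?thesis by (metis butlast_snoc image_eqI)
      next
        case False
        then have va: "v = a0 w # w" using v w_def by (auto simp: L_def)
        show ?thesis
        proof (cases "bis w")
          case True
          then obtain b where b: "w @ [b] \<in> W" "b \<noteq> b0 w" unfolding bis_def by metis
          then have "w @ [b] \<in> R" by (auto simp: R_def)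
          then have "a0 w # w @ [b] \<in> W'" by (force simp: W'_def S1_def)
          moreover have "butlast (a0 w # w @ [b]) = v" using va by (metis append_Cons butlast_snoc)
          ultimately show ?thesis by blast
        next
          case False
          then have "a0 w # w @ [b0 w] \<in> W'" using w by (auto simp: W'_def S0_def)
          moreover have "butlast (a0 w # w @ [b0 w]) = v" using va by (metis append_Cons butlast_snoc)
          ultimately show ?thesis by blast
        qed
      qed
    qed
  qed (use butlast_sub in blast)
  have tl: "tl ` W' = W"
  proof
    show "W \<subseteq> tl ` W'"
    proof
      fix v assume v: "v \<in> W"
      define w where "w = butlast v"
      have w: "w \<in> V" "v = w @ [last v]" using blV v nn w_def by auto
      show "v \<in> tl ` W'"
      proof (cases "v \<in> R")
        case True
        then have "a0 (butlast v) # v \<in> W'" by (simp add: W'_def S1_def)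
        then show ?thesis by (metis list.sel(3) image_eqI)
      next
        case False
        then have va: "v = w @ [b0 w]" using v w_def by (auto simp: R_def)
        show ?thesis
        proof (cases "bis w")
          case True
          then obtain a where a: "a # w \<in> W" "a \<noteq> a0 w" unfolding bis_def by metis
          then have "a # w \<in> L" by (auto simp: L_def)
          then have "a # w @ [b0 w] \<in> W'" by (force simp: W'_def S2_def)
          then show ?thesis using va by (metis list.sel(3) image_eqI)
        next
          case False
          then have "a0 w # w @ [b0 w] \<in> W'" using w by (auto simp: W'_def S0_def)
          then show ?thesis using va by (metis list.sel(3) image_eqI)
        qed
      qed
    qed
  qed (use tl_sub in blast)
  have "finite W'" using finV finR by (simp add: W'_def S0_def S1_def S2_def)
  moreover have "W' \<noteq> {}" using bl neW by blast
  moreover have "length u = Suc (Suc m)" if "u \<in> W'" for u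
  proof -
    have "length u - 1 = Suc m" using len[OF butlast_sub[OF that]] by simp
    then show ?thesis by simp
  qed
  ultimately have "extendable (Suc m) W'" unfolding extendable_def using bl tl by simp
  then show ?thesis using that[of W'] bl tl c1 c2 by (simp add: V_def)
qed

text \<open>The induction measure is the first difference of the complexity at \<open>m\<close>. Up
  to the first length with a bispecial word extensions are unique, hence equal to the sparse ones,
  and the difference cannot grow; the sparse choice made at that length then lowers it.\<close>

lemma extendable_imp_lang_determined:
  assumes "extendable m W"
  shows "\<exists>Z. subshift Z \<and> lang_determined Z \<and> lang (Suc m) Z = W"
  using assms
proof (induction "card W - card (butlast ` W)" arbitrary: m W rule: less_induct)
  case less
  define X where "X = sft (Suc m) W"
  have X: "subshift X" "lang (Suc m) X = W"
    using subshift_sft lang_sft less.prems by (simp_all add: X_def)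
  define c where "c n = card (lang n X)" for n
  have c_mono: "c n \<le> c (Suc n)" for n
    unfolding c_def butlast_lang[symmetric, of n] by (intro card_image_le finite_lang X)
  have d: "card W - card (butlast ` W) = c (Suc m) - c m"
    unfolding c_def X(2)[symmetric] butlast_lang ..
  show ?case
  proof (cases "\<forall>n\<ge>m. bispecial_free (lang (Suc n) X)")
    case True
    then show ?thesis using lang_determinedI X by blast
  next
    case False
    define n where "n = (LEAST n. n \<ge> m \<and> \<not> bispecial_free (lang (Suc n) X))"
    have n: "n \<ge> m" "\<not> bispecial_free (lang (Suc n) X)"
      using LeastI_ex[of "\<lambda>n. n \<ge> m \<and> \<not> bispecial_free (lang (Suc n) X)"] False unfolding n_def by auto
    have bf: "bispecial_free (lang (Suc k) X)" if "k \<ge> m" "k < n" for k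
      using not_less_Least[of k "\<lambda>n. n \<ge> m \<and> \<not> bispecial_free (lang (Suc n) X)"] that
      unfolding n_def by blast
    have "k \<le> n \<longrightarrow> c (Suc k) - c k \<le> c (Suc m) - c m" if "k \<ge> m" for k
      using that
    proof (induction k rule: dec_induct)
      case (step k)
      show ?case
      proof
        assume k: "Suc k \<le> n"
        obtain W' where W': "butlast ` W' = lang (Suc k) X" "tl ` W' = lang (Suc k) X"
          "extendable (Suc k) W'" "card W' + card (butlast ` lang (Suc k) X) \<le> 2 * card (lang (Suc k) X)"
          using sparse_extension[OF extendable_lang[OF X(1)], of k] by metis
        have "lang (Suc (Suc k)) X = W'"
          by (rule bispecial_free_extension_unique[OF bf[of k]])
             (use W' k step in \<open>auto simp: butlast_lang tl_lang length_lang extendable_def\<close>)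
        then have "c (Suc (Suc k)) + c k \<le> 2 * c (Suc k)"
          using W'(4) by (simp add: c_def butlast_lang)
        then show "c (Suc (Suc k)) - c (Suc k) \<le> c (Suc m) - c m" using step.IH k by linarith
      qed
    qed simp
    then have cn: "c (Suc n) - c n \<le> c (Suc m) - c m" using n by blast
    obtain W' where W': "extendable (Suc n) W'" "butlast ` W' = lang (Suc n) X"
      "card W' + c n < 2 * c (Suc n)"
      using sparse_extension[OF extendable_lang[OF X(1)], of n] n(2) by (metis butlast_lang c_def)
    \<comment> \<open>This keeps the subtraction on naturals from being truncated; otherwise the
      measure could be 0 on both sides.\<close>
    have "card (lang (Suc n) X) \<le> card W'"
      unfolding W'(2)[symmetric] using W'(1) by (intro card_image_le) (simp add: extendable_def)
    then have "card W' - card (butlast ` W') < card W - card (butlast ` W)"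
      using W'(2,3) cn d by (simp add: c_def)
    then obtain Z where Z: "subshift Z" "lang_determined Z" "lang (Suc (Suc n)) Z = W'"
      using less.hyps W'(1) by blast
    then have "lang (Suc n) Z = lang (Suc n) X" using W'(2) by (metis butlast_lang)
    then have "lang (Suc m) Z = W" using lang_eq_mono[of "Suc n" Z X "Suc m"] n(1) X(2) by simp
    then show ?thesis using Z by blast
  qed
qed

theorem lang_determined_dense:
  assumes "subshift X"
  shows "\<exists>Z. subshift Z \<and> lang_determined Z \<and> lang n Z = lang n X"
proof -
  obtain Z where Z: "subshift Z" "lang_determined Z" "lang (Suc n) Z = lang (Suc n) X"
    using extendable_imp_lang_determined[OF extendable_lang[OF assms]] by blast
  then have "lang n Z = lang n X" by (metis butlast_lang)
  then show ?thesis using Z by blast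
qed

section \<open>Middle cycles\<close>

text \<open>
  The periodic sequence \<open>x\<close> traverses a cycle of the Rauzy graph with arc set \<open>W\<close>; the words ending
  in \<open>factor x i m\<close> and beginning with \<open>factor x j m\<close> are arcs entering and leaving it. Chords of
  the cycle are allowed, which makes the notion slightly weaker than a middle cycle in the sense of
  the definition of \<open>no_middle_cycles\<close>.
\<close>

definition middle_cycle :: "nat \<Rightarrow> int list set \<Rightarrow> bool" where
  "middle_cycle m W \<longleftrightarrow> (\<exists>x q i j a b. 0 < q \<and> (\<forall>k. x (k + int q) = x k) \<and>
     (\<forall>k. factor x k (Suc m) \<in> W) \<and>
     a \<noteq> x (i - 1) \<and> a # factor x i m \<in> W \<and>
     b \<noteq> x (j + int m) \<and> factor x j m @ [b] \<in> W)"

lemma periodic_mult: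
  assumes "\<And>k :: int. x (k + int q) = x k"
  shows "x (k + int t * int q) = x k"
proof (induction t)
  case (Suc t)
  have "x (k + int (Suc t) * int q) = x (k + int t * int q + int q)" by (simp add: algebra_simps)
  then show ?case using Suc assms by simp
qed simp

text \<open>
  The forbidden word \<open>a x\<^sub>i \<dots> x\<^sub>j\<^sub>+\<^sub>m\<^sub>-\<^sub>1 b\<close> runs along the cycle from an entering to a leaving arc;
  it does not respect the period of \<open>x\<close> at either end, so the cycle survives together with
  entering and leaving words.
\<close>

lemma middle_cycle_step:
  assumes W: "extendable m W" and mc: "middle_cycle m W"
  obtains M W' where "N \<le> M" "extendable (Suc M) W'" "middle_cycle (Suc M) W'"
    "lang (Suc M) (sft (Suc (Suc M)) W') = lang (Suc M) (sft (Suc m) W)"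
    "sft (Suc (Suc M)) W' \<noteq> sft (Suc m) W"
proof -
  define X where "X = sft (Suc m) W"
  have X: "subshift X" "lang (Suc m) X = W"
    using subshift_sft lang_sft W by (simp_all add: X_def)
  obtain x q i j0 a b where q: "0 < q" and per: "\<And>k. x (k + int q) = x k"
    and xW: "\<And>k. factor x k (Suc m) \<in> W"
    and a: "a \<noteq> x (i - 1)" "a # factor x i m \<in> W"
    and b0: "b \<noteq> x (j0 + int m)" "factor x j0 m @ [b] \<in> W"
    using mc unfolding middle_cycle_def by metis
  \<comment> \<open>The leaving place is moved by \<open>t\<close> periods so that it lies at least
    \<open>N + q\<close> after the entering place \<open>i\<close>.\<close>
  define t where "t = N + q + nat (i - j0)"
  define j where "j = j0 + int t * int q"
  have "int t \<le> int t * int q" using q by (simp add: mult_le_cancel_left1)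
  then have j: "j \<ge> i + int N + int q" unfolding j_def t_def by linarith
  have "x (j + int l) = x (j0 + int l)" for l
    using periodic_mult[of x q "j0 + int l" t] per by (simp add: j_def algebra_simps)
  then have b: "b \<noteq> x (j + int m)" "factor x j m @ [b] \<in> W"
    using b0 by (simp_all add: factor_def)
  \<comment> \<open>\<open>M\<close> counts the letters of \<open>x\<close> from \<open>i\<close> to
    \<open>j + m - 1\<close>. It is at least \<open>N\<close>, and at least one full period.\<close>
  define M where "M = nat (j - i) + m"
  have M: "N \<le> M" "q \<le> M" "i + int M = j + int m" using j by (auto simp: M_def)
  have xX: "x \<in> X" using xW by (simp add: X_def sft_iff)
  obtain z1 where z1: "z1 \<in> X" "factor z1 (i - 1) (Suc m) = a # factor x i m"
    using lang_translate[of "a # factor x i m" "Suc m" X "i - 1"] X a(2) by auto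
  then have z1': "z1 (i - 1) = a" "factor z1 i m = factor x i m" by (simp_all add: factor_Cons)
  \<comment> \<open>\<open>y1\<close> enters the cycle and stays, \<open>y2\<close> follows it from
    the past and leaves, \<open>y3\<close> does both and contains \<open>u\<close>.\<close>
  define y1 where "y1 k = (if k < i then z1 k else x k)" for k
  have y1: "y1 \<in> X" unfolding y1_def X_def
    using glue_sft z1 z1' xX X_def by auto
  obtain z2 where z2: "z2 \<in> X" "factor z2 j (Suc m) = factor x j m @ [b]"
    using lang_translate[of "factor x j m @ [b]" "Suc m" X j] X b(2) by auto
  then have z2': "factor x j m = factor z2 j m" "z2 (j + int m) = b" by (simp_all add: factor_Suc)
  define y2 where "y2 k = (if k < j then x k else z2 k)" for k
  have y2: "y2 \<in> X" unfolding y2_def X_def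
    using glue_sft z2 z2' xX X_def by auto
  define y3 where "y3 k = (if k < j then y1 k else z2 k)" for k
  have "factor y1 j m = factor x j m" using j by (simp add: factor_eq_iff y1_def)
  then have y3: "y3 \<in> X" unfolding y3_def X_def
    using glue_sft z2 z2' y1 X_def by auto
  have z2x: "z2 k = x k" if "j \<le> k" "k < j + int m" for k
  proof -
    have "k = j + int (nat (k - j))" "nat (k - j) < m" using that by auto
    then show ?thesis using z2'(1) by (metis factor_eq_iff)
  qed
  define u where "u = a # factor x i M @ [b]"
  have f3: "factor y3 (i - 1) (Suc (Suc M)) = u"
  proof -
    have "factor y3 i M = factor x i M"
      unfolding factor_eq_iff y3_def y1_def using z2x M(3) by auto
    moreover have "y3 (i + int M) = b" using z2'(2) M(3) by (simp add: y3_def)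
    moreover have "y3 (i - 1) = a" using z1' j by (simp add: y3_def y1_def)
    ultimately show ?thesis using factor_Cons[of y3 "i - 1" "Suc M"] factor_Suc[of y3 i M]
      by (simp add: u_def)
  qed
  have f1: "factor y1 (i - 1) (Suc (Suc M)) = a # factor x i (Suc M)"
  proof -
    have "factor y1 i (Suc M) = factor x i (Suc M)" unfolding factor_eq_iff y1_def by auto
    moreover have "y1 (i - 1) = a" using z1' by (simp add: y1_def)
    ultimately show ?thesis by (simp add: factor_Cons[of y1 "i - 1"])
  qed
  have f2: "factor y2 (i - 1) (Suc (Suc M)) = factor x (i - 1) (Suc M) @ [b]"
  proof -
    have "factor y2 (i - 1) (Suc M) = factor x (i - 1) (Suc M)"
      unfolding factor_eq_iff y2_def using z2x M(3) by auto
    moreover have "y2 (i + int M) = b" using z2'(2) M(3) by (simp add: y2_def)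
    ultimately show ?thesis by (simp add: factor_Suc[of y2 "i - 1"])
  qed
  define W' where "W' = lang (Suc (Suc M)) X - {u}"
  have bx: "b \<noteq> x (i + int M)" using b M(3) by simp
  \<comment> \<open>This word has the same prefix of length \<open>M + 1\<close> as
    \<open>u\<close>, and the next one the same suffix, so deleting \<open>u\<close> loses no
    shorter word.\<close>
  have u1: "a # factor x i (Suc M) \<in> W'"
    using factor_in_lang[OF y1, of "i - 1" "Suc (Suc M)", unfolded f1] bx
    by (auto simp: W'_def u_def factor_Suc)
  have u2: "factor x (i - 1) (Suc M) @ [b] \<in> W'"
    using factor_in_lang[OF y2, of "i - 1" "Suc (Suc M)", unfolded f2] a(1)
    by (auto simp: W'_def u_def factor_Cons)
  have bl: "butlast ` W' = lang (Suc M) X"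
  proof
    show "butlast ` W' \<subseteq> lang (Suc M) X" using butlast_lang[of "Suc M" X] by (auto simp: W'_def)
    show "lang (Suc M) X \<subseteq> butlast ` W'"
    proof
      fix v assume "v \<in> lang (Suc M) X"
      then obtain v' where v': "v' \<in> lang (Suc (Suc M)) X" "v = butlast v'"
        using butlast_lang by blast
      show "v \<in> butlast ` W'"
      proof (cases "v' = u")
        case True
        have "butlast u = butlast (a # factor x i (Suc M))"
          by (simp add: u_def factor_Suc butlast_append)
        then show ?thesis using True v' u1 by blast
      qed (use v' W'_def in auto)
    qed
  qed
  have tl: "tl ` W' = lang (Suc M) X"
  proof
    show "tl ` W' \<subseteq> lang (Suc M) X" using tl_lang[of "Suc M" X] by (auto simp: W'_def)
    show "lang (Suc M) X \<subseteq> tl ` W'"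
    proof
      fix v assume "v \<in> lang (Suc M) X"
      then obtain v' where v': "v' \<in> lang (Suc (Suc M)) X" "v = tl v'"
        using tl_lang by blast
      show "v \<in> tl ` W'"
      proof (cases "v' = u")
        case True
        have "tl u = tl (factor x (i - 1) (Suc M) @ [b])"
          by (simp add: u_def factor_Cons)
        then show ?thesis using True v' u2 by blast
      qed (use v' W'_def in auto)
    qed
  qed
  have ext: "extendable (Suc M) W'"
    unfolding extendable_def using bl tl u1 finite_lang[OF X(1)]
    by (auto simp: W'_def length_lang)
  have "middle_cycle (Suc M) W'"
    unfolding middle_cycle_def
  proof (intro exI conjI allI)
    show "0 < q" "\<And>k. x (k + int q) = x k" "a \<noteq> x (i - 1)" by fact+
    show "a # factor x i (Suc M) \<in> W'" "factor x (i - 1) (Suc M) @ [b] \<in> W'" by fact+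
    show "b \<noteq> x (i - 1 + int (Suc M))" using bx by simp
    show "factor x k (Suc (Suc M)) \<in> W'" for k
    proof -
      \<comment> \<open>In a word of \<open>x\<close> longer than \<open>q\<close> the first letter
        recurs \<open>q\<close> places later, whereas \<open>u\<close> starts with \<open>a\<close>
        and has \<open>x (i - 1)\<close> at place \<open>q\<close>.\<close>
      have "factor x k (Suc (Suc M)) \<noteq> u"
      proof
        assume eq: "factor x k (Suc (Suc M)) = u"
        have "x k = a" using eq by (simp add: u_def factor_Cons)
        have qM: "q - 1 < M" using q M(2) by simp
        have "x (k + int q) = u ! q" using M(2) by (simp flip: eq)
        also have "\<dots> = factor x i M ! (q - 1)"
          using q qM by (simp add: u_def nth_Cons' nth_append)
        also have "\<dots> = x (i + int (q - 1))" using qM by (rule nth_factor)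
        also have "i + int (q - 1) = i - 1 + int q" using q by simp
        also have "x (i - 1 + int q) = x (i - 1)" by (rule per)
        finally show False using per[of k] \<open>x k = a\<close> a(1) by simp
      qed
      then show ?thesis using factor_in_lang[OF xX] by (simp add: W'_def)
    qed
  qed
  moreover have "lang (Suc M) (sft (Suc (Suc M)) W') = lang (Suc M) X"
    using lang_sft[OF ext] bl by (metis butlast_lang)
  moreover have "sft (Suc (Suc M)) W' \<noteq> X"
  proof -
    have "y3 \<notin> sft (Suc (Suc M)) W'" using f3 unfolding sft_iff W'_def by blast
    then show ?thesis using y3 by blast
  qed
  ultimately show ?thesis using that M(1) ext unfolding X_def by blast
qed

text \<open>Whatever length is proposed, \<open>middle_cycle_step\<close> supplies a different
  subshift with the same words up to a larger one.\<close>

lemma middle_cycle_imp_not_determined: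
  assumes "extendable m W" "middle_cycle m W"
  shows "\<not> lang_determined (sft (Suc m) W)"
proof
  assume "lang_determined (sft (Suc m) W)"
  then obtain n where n: "\<And>Z. subshift Z \<Longrightarrow> lang n Z = lang n (sft (Suc m) W) \<Longrightarrow> Z = sft (Suc m) W"
    unfolding lang_determined_def by blast
  obtain M W' where M: "n \<le> M" "extendable (Suc M) W'"
    "lang (Suc M) (sft (Suc (Suc M)) W') = lang (Suc M) (sft (Suc m) W)"
    "sft (Suc (Suc M)) W' \<noteq> sft (Suc m) W"
    using middle_cycle_step[OF assms] by metis
  have "lang n (sft (Suc (Suc M)) W') = lang n (sft (Suc m) W)"
    by (rule lang_eq_mono[OF M(3)]) (use M(1) in simp)
  then show False using n[OF subshift_sft[OF M(2)]] M(4) by blast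
qed

text \<open>
  A long bispecial word repeats a factor of length \<open>m\<close>; the periodic sequence reading the segment
  between the two occurrences is left at both ends, at the latest by one of the extensions.
\<close>

lemma bispecial_imp_middle_cycle:
  assumes n: "m + card (lang m X) \<le> n" and fin: "finite (lang m X)"
    and bis: "\<not> bispecial_free (lang (Suc n) X)"
  shows "middle_cycle m (lang (Suc m) X)"
proof -
  obtain w a a' b b' where w: "a # w \<in> lang (Suc n) X" "a' # w \<in> lang (Suc n) X"
    "w @ [b] \<in> lang (Suc n) X" "w @ [b'] \<in> lang (Suc n) X" and ab: "a \<noteq> a'" "b \<noteq> b'"
    using bis unfolding bispecial_free_def by blast
  have "tl (a # w) \<in> lang n X" using w(1) tl_lang by blast
  then have "w \<in> lang n X" by simp
  then obtain y0 i0 where y0: "y0 \<in> X" "w = factor y0 i0 n" by (auto simp: lang_eq_factor)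
  define y where "y k = y0 (k + i0)" for k
  have wy: "w = factor y 0 n" by (simp add: y_def y0 factor_def algebra_simps)
  have "factor y k l = factor y0 (k + i0) l" for k l
    by (simp add: factor_eq_iff y_def algebra_simps)
  then have sub: "factor y k l \<in> lang l X" for k l
    using factor_in_lang[OF y0(1)] by simp
  define c where "c = card (lang m X)"
  \<comment> \<open>There are \<open>c + 1\<close> starting places for \<open>c\<close> words, and
    \<open>m + c \<le> n\<close> keeps all these windows inside \<open>w\<close>.\<close>
  have "(\<lambda>s. factor y (int s) m) ` {..c} \<subseteq> lang m X"
    using sub by blast
  then have "card ((\<lambda>s. factor y (int s) m) ` {..c}) < card {..c}"
    using card_mono[OF fin] by (simp add: c_def le_imp_less_Suc)
  then have "\<not> inj_on (\<lambda>s. factor y (int s) m) {..c}" using pigeonhole by blast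
  then obtain s0 t0 where "s0 \<in> {..c}" "t0 \<in> {..c}" "s0 \<noteq> t0"
    "factor y (int s0) m = factor y (int t0) m" unfolding inj_on_def by blast
  then obtain s t where st: "s < t" "t \<le> c" "factor y (int s) m = factor y (int t) m"
    by (metis atMost_iff linorder_neqE_nat)
  have rep: "y (int s + int l) = y (int t + int l)" if "l < m" for l
    using st(3) that by (simp add: factor_eq_iff)
  define q where "q = t - s"
  have q: "0 < q" "int q = int t - int s" using st by (auto simp: q_def)
  define x where "x k = y (int s + (k - int s) mod int q)" for k
  have per: "x (k + int q) = x k" for k
  proof -
    have "(k + int q - int s) mod int q = (k - int s + int q) mod int q" by (simp add: algebra_simps)
    then show ?thesis by (simp add: x_def)
  qed
  \<comment> \<open>By construction the agreement reaches up to \<open>t\<close>; the recurrence of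
    the window at \<open>t\<close> prolongs it by \<open>m\<close> letters.\<close>
  have xy: "x k = y k" if "int s \<le> k" "k < int t + int m" for k
  proof -
    have "x (int s + int l) = y (int s + int l)" if "l < q + m" for l
      using that
    proof (induction l rule: less_induct)
      case (less l)
      show ?case
      proof (cases "l < q")
        case True
        then show ?thesis by (simp add: x_def)
      next
        case False
        have "int s + int l = int s + int (l - q) + int q" using False by simp
        then have "x (int s + int l) = x (int s + int (l - q))" using per by metis
        also have "\<dots> = y (int s + int (l - q))"
          by (rule less.IH) (use less.prems False q(1) in auto)
        also have "\<dots> = y (int t + int (l - q))"
          by (rule rep) (use less.prems False in auto)
        also have "int t + int (l - q) = int s + int l" using False q by (simp add: of_nat_diff)
        finally show ?thesis .
      qed
    qed
    from this[of "nat (k - int s)"] show ?thesis using that q by simp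
  qed
  have tn: "t + m \<le> n" using st n by (simp add: c_def)
  have xW: "factor x k (Suc m) \<in> lang (Suc m) X" for k
  proof -
    define k' where "k' = int s + (k - int s) mod int q"
    have "0 \<le> (k - int s) mod int q" "(k - int s) mod int q < int q" using q(1) by simp_all
    then have k': "int s \<le> k'" "k' < int t" using q(2) unfolding k'_def by linarith+
    have "x (k + int l) = x (k' + int l)" for l
      unfolding x_def k'_def by (simp add: mod_simps algebra_simps)
    moreover have "x (k' + int l) = y (k' + int l)" if "l < Suc m" for l
      using xy k' that by simp
    ultimately have "factor x k (Suc m) = factor y k' (Suc m)" by (simp add: factor_eq_iff)
    then show ?thesis using sub by simp
  qed
  have left: "\<exists>i a. a \<noteq> x (i - 1) \<and> a # factor x i m \<in> lang (Suc m) X"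
  proof (cases "\<exists>k<s. x (int k) \<noteq> y (int k)")
    case True
    \<comment> \<open>At the disagreement nearest to \<open>s\<close>, the \<open>m\<close> letters
      that follow already agree with \<open>x\<close>, so a word entering the cycle starts
      there.\<close>
    define k where "k = Max {k. k < s \<and> x (int k) \<noteq> y (int k)}"
    have "k \<in> {k. k < s \<and> x (int k) \<noteq> y (int k)}"
      unfolding k_def by (rule Max_in) (use True in auto)
    then have k: "k < s" "x (int k) \<noteq> y (int k)" by auto
    have kx: "x (int l) = y (int l)" if "k < l" "l < s" for l
    proof (rule ccontr)
      assume "x (int l) \<noteq> y (int l)"
      then have "l \<le> k" unfolding k_def using that by (intro Max_ge) auto
      then show False using that by simp
    qed
    have "x (int k + 1 + int l) = y (int k + 1 + int l)" if "l < m" for l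
    proof (cases "k + 1 + l < s")
      case True
      then show ?thesis using kx[of "k + 1 + l"] by (simp add: algebra_simps)
    next
      case False
      then show ?thesis using xy[of "int k + 1 + int l"] that k st(1) by linarith
    qed
    then have "y (int k) # factor x (int k + 1) m = factor y (int k) (Suc m)"
      by (simp add: factor_Cons factor_eq_iff)
    then show ?thesis
      using k sub by (intro exI[of _ "int k + 1"] exI[of _ "y (int k)"]) simp
  next
    case False
    have "x (int l) = y (int l)" if "l < t + m" for l
      using False xy[of "int l"] that by (cases "l < s") auto
    then have fx: "factor x 0 m = factor y 0 m" using st by (simp add: factor_eq_iff)
    have "take (Suc m) (d # w) = d # factor x 0 m" for d
      using tn by (simp add: wy take_factor fx)
    then have "d # factor x 0 m \<in> lang (Suc m) X" if "d # w \<in> lang (Suc n) X" for d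
      using take_in_lang[OF that, of "Suc m"] tn by simp
    then show ?thesis using w(1,2) ab(1) by (metis diff_0)
  qed
  have right: "\<exists>j b. b \<noteq> x (j + int m) \<and> factor x j m @ [b] \<in> lang (Suc m) X"
  proof (cases "\<exists>k. t + m \<le> k \<and> k < n \<and> x (int k) \<noteq> y (int k)")
    case True
    define k where "k = (LEAST k. t + m \<le> k \<and> k < n \<and> x (int k) \<noteq> y (int k))"
    have k: "t + m \<le> k" "k < n" "x (int k) \<noteq> y (int k)"
      using LeastI_ex[OF True] by (auto simp: k_def)
    have kx: "x (int l) = y (int l)" if "t + m \<le> l" "l < k" for l
      using not_less_Least[of l "\<lambda>k. t + m \<le> k \<and> k < n \<and> x (int k) \<noteq> y (int k)"] that k
      unfolding k_def by auto
    have "x (int (k - m) + int l) = y (int (k - m) + int l)" if "l < m" for l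
    proof (cases "t + m \<le> k - m + l")
      case True
      have "x (int (k - m + l)) = y (int (k - m + l))" by (rule kx) (use True that k in auto)
      then show ?thesis by (metis of_nat_add)
    next
      case False
      then show ?thesis using xy[of "int (k - m) + int l"] k st(1) by linarith
    qed
    moreover have "int (k - m) + int m = int k" using k by simp
    ultimately have "factor x (int (k - m)) m @ [y (int k)] = factor y (int (k - m)) (Suc m)"
      by (simp add: factor_Suc factor_eq_iff)
    then show ?thesis
      using k sub \<open>int (k - m) + int m = int k\<close>
      by (intro exI[of _ "int (k - m)"] exI[of _ "y (int k)"]) simp
  next
    case False
    have xl: "x (int l) = y (int l)" if "s \<le> l" "l < n" for l
      using False xy[of "int l"] that by (cases "l < t + m") auto
    have "x (int (n - m + l)) = y (int (n - m + l))" if "l < m" for l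
      by (rule xl) (use that tn st in linarith)+
    then have fx: "factor x (int (n - m)) m = factor y (int (n - m)) m"
      by (simp add: factor_eq_iff)
    have "n - (n - m) = m" using tn by simp
    then have "drop (n - m) w = factor x (int (n - m)) m" unfolding wy drop_factor fx by simp
    then have "drop (Suc n - Suc m) (w @ [d]) = factor x (int (n - m)) m @ [d]" for d
      by (simp add: wy)
    then have "factor x (int (n - m)) m @ [d] \<in> lang (Suc m) X" if "w @ [d] \<in> lang (Suc n) X" for d
      using drop_in_lang[OF that, of "Suc m"] tn by simp
    then show ?thesis using w(3,4) ab(2) by metis
  qed
  show ?thesis
    unfolding middle_cycle_def using q(1) per xW left right by metis
qed

lemma no_middle_cycle_imp_determined:
  assumes X: "subshift X" and "\<not> middle_cycle m (lang (Suc m) X)"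
  shows "lang_determined X"
proof (rule lang_determinedI[OF X])
  show "bispecial_free (lang (Suc n) X)" if "m + card (lang m X) \<le> n" for n
    using bispecial_imp_middle_cycle[OF that finite_lang[OF X]] assms(2) by blast
qed

text \<open>\<open>X\<close> has a middle cycle at each length, so its finite type approximation of
  window \<open>Suc n\<close> is not determined either. If that approximation is \<open>X\<close>
  itself, one modification along the cycle provides the other subshift.\<close>

theorem not_determined_perfect:
  assumes X: "subshift X" "\<not> lang_determined X"
  shows "\<exists>Z. subshift Z \<and> \<not> lang_determined Z \<and> Z \<noteq> X \<and> lang n Z = lang n X"
proof -
  define W where "W = lang (Suc n) X"
  have W: "extendable n W" "middle_cycle n W"
    using extendable_lang no_middle_cycle_imp_determined X by (auto simp: W_def)
  show ?thesis
  proof (cases "sft (Suc n) W = X")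
    case False
    have "lang (Suc n) (sft (Suc n) W) = lang (Suc n) X"
      using lang_sft[OF W(1)] by (simp add: W_def)
    then have "lang n (sft (Suc n) W) = lang n X" by (metis butlast_lang)
    then show ?thesis
      using False subshift_sft[OF W(1)] middle_cycle_imp_not_determined[OF W] by blast
  next
    case True
    obtain M W' where M: "n \<le> M" "extendable (Suc M) W'" "middle_cycle (Suc M) W'"
      "lang (Suc M) (sft (Suc (Suc M)) W') = lang (Suc M) X" "sft (Suc (Suc M)) W' \<noteq> X"
      using middle_cycle_step[OF W] True by metis
    have "lang n (sft (Suc (Suc M)) W') = lang n X"
      by (rule lang_eq_mono[OF M(4)]) (use M(1) in simp)
    then show ?thesis
      using M(5) subshift_sft[OF M(2)] middle_cycle_imp_not_determined[OF M(2,3)] by blast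
  qed
qed

section \<open>Shifts of finite type\<close>

text \<open>Windows at least as long as all forbidden words see every violation, and being nonempty
  they also see the alphabet.\<close>

lemma sft_lang_eq:
  assumes "shift_of_finite_type Y"
  shows "\<exists>r. \<forall>m\<ge>r. sft (Suc m) (lang (Suc m) Y) = Y"
proof -
  obtain A F where AF: "finite A" "finite F" "Y = {x. range x \<subseteq> A \<and> (\<forall>w\<in>F. \<not> occurs_in w x)}"
    using assms unfolding shift_of_finite_type_def by blast
  define r where "r = Max (insert 0 (length ` F))"
  have r: "length w \<le> r" if "w \<in> F" for w
    unfolding r_def using AF(2) that by (intro Max_ge) auto
  show ?thesis
  proof (intro exI allI impI)
    fix m assume "r \<le> m"
    show "sft (Suc m) (lang (Suc m) Y) = Y"
    proof
      show "sft (Suc m) (lang (Suc m) Y) \<subseteq> Y"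
      proof
        fix x assume x: "x \<in> sft (Suc m) (lang (Suc m) Y)"
        have ex: "\<exists>y\<in>Y. \<exists>j. factor x i (Suc m) = factor y j (Suc m)" for i
        proof -
          have "factor x i (Suc m) \<in> lang (Suc m) Y" using x by (simp add: sft_iff)
          then show ?thesis by (auto simp: lang_eq_factor)
        qed
        have "x i \<in> A" for i
        proof -
          obtain y j where "y \<in> Y" "factor x i (Suc m) = factor y j (Suc m)" using ex by blast
          then have "x i = y j" "range y \<subseteq> A" using AF(3) by (auto simp: factor_Cons)
          then show ?thesis by auto
        qed
        moreover have "\<not> occurs_in w x" if w: "w \<in> F" for w
        proof
          assume "occurs_in w x"
          then obtain i where i: "w = factor x i (length w)" by (auto simp: occurs_in_iff_factor)
          obtain y j where y: "y \<in> Y" "factor x i (Suc m) = factor y j (Suc m)" using ex by blast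
          have "length w \<le> Suc m" using r[OF w] \<open>r \<le> m\<close> by simp
          then have "factor x i (length w) = factor y j (length w)" using y(2) by (metis take_factor)
          then have "occurs_in w y" using i by (metis occurs_in_iff_factor)
          then show False using y(1) AF(3) w by blast
        qed
        ultimately show "x \<in> Y" unfolding AF(3) by blast
      qed
    qed (rule subset_sft_lang)
  qed
qed

section \<open>Cycles of Rauzy graphs as periodic sequences\<close>

lemma cas_nth:
  "pre_digraph.cas G u p v \<Longrightarrow> Suc i < length p \<Longrightarrow> head G (p ! i) = tail G (p ! Suc i)"
proof (induction p arbitrary: u i)
  case (Cons e p)
  then show ?case
    by (cases p; cases i) (auto simp: pre_digraph.cas.simps)
qed simp

lemma cas_last: "pre_digraph.cas G u p v \<Longrightarrow> p \<noteq> [] \<Longrightarrow> head G (last p) = v"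
  by (induction p arbitrary: u) (auto simp: pre_digraph.cas.simps)

text \<open>Going round the cycle for ever spells a periodic \<open>x\<close>. If an entering arc
  began with the letter that \<open>x\<close> has there, it would be an arc of the cycle and its
  tail a vertex of it; likewise for leaving arcs. The bound on \<open>m\<close> is
  \<open>n \<ge> 2\<close> in \<open>NMC\<close>.\<close>

lemma not_NMC_imp_middle_cycle:
  assumes "\<not> NMC Y" "1 \<le> m"
  shows "middle_cycle m (lang (Suc m) Y)"
proof -
  define G where "G = rauzy_graph Y (Suc m)"
  have G: "arcs G = lang (Suc m) Y" "tail G = butlast" "head G = tl"
    by (simp_all add: G_def rauzy_graph_def)
  have "\<not> no_middle_cycles G" using assms unfolding NMC_def G_def by fastforce
  then obtain p where p: "pre_digraph.cycle G p"
    and inc: "has_incoming_arc G (tail G ` set p)" and out: "has_outgoing_arc G (tail G ` set p)"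
    unfolding no_middle_cycles_def by blast
  obtain v where v: "pre_digraph.awalk G v p v" "p \<noteq> []"
    using p unfolding pre_digraph.cycle_def by blast
  have pW: "set p \<subseteq> lang (Suc m) Y" and cas: "pre_digraph.cas G v p v"
    using v(1) by (simp_all add: pre_digraph.awalk_def G)
  define l where "l = length p"
  have l: "0 < l" using v(2) by (simp add: l_def)
  have hd_v: "butlast (p ! 0) = v"
    using cas v(2) by (cases p) (auto simp: pre_digraph.cas.simps G)
  define g where "g k = p ! nat (k mod int l)" for k
  have gp: "g k \<in> set p" for k unfolding g_def using l by (simp add: l_def nat_less_iff)
  have step: "tl (g k) = butlast (g (k + 1))" for k
  proof -
    define i where "i = nat (k mod int l)"
    have i: "i < l" "int i = k mod int l" using l by (auto simp: i_def nat_less_iff)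
    have k1: "(k + 1) mod int l = (int i + 1) mod int l" by (simp add: i mod_simps)
    show ?thesis
    proof (cases "Suc i < l")
      case True
      then have "nat ((k + 1) mod int l) = Suc i" using k1 by simp
      then show ?thesis using cas_nth[OF cas, of i] True by (simp add: g_def i_def G l_def)
    next
      \<comment> \<open>After the last arc the index returns to 0, and the walk is closed.\<close>
      case False
      then have il: "Suc i = l" using i by simp
      then have "int i + 1 = int l" by simp
      then have "nat ((k + 1) mod int l) = 0" using k1 by simp
      moreover have "p ! i = last p" using il v(2) by (metis diff_Suc_1 last_conv_nth l_def)
      ultimately show ?thesis using cas_last[OF cas v(2)] hd_v by (simp add: g_def G flip: i_def)
    qed
  qed
  define x where "x k = hd (g k)" for k
  have fx: "factor x k (Suc m) = g k" for k
    unfolding x_def by (intro factor_path[where g = g] step) (rule length_lang[OF subsetD[OF pW gp]])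
  have fx_butlast: "factor x k m = butlast (g k)" for k by (metis butlast_factor fx)
  have per: "x (k + int l) = x k" for k by (simp add: x_def g_def)
  have set_g: "\<exists>k. e = g k" if "e \<in> set p" for e
  proof -
    have "\<exists>i<l. p ! i = e" using that by (simp only: in_set_conv_nth l_def)
    then obtain i where i: "i < l" "p ! i = e" by (elim exE conjE)
    then have "e = g (int i)" by (simp add: g_def)
    then show ?thesis by (rule exI)
  qed
  obtain e i where e: "e \<in> lang (Suc m) Y" "tl e = butlast (g i)" "butlast e \<notin> butlast ` set p"
    using inc set_g unfolding has_incoming_arc_def G by (metis imageE)
  have e_eq: "e = hd e # factor x i m"
    using e(1,2) length_lang[OF e(1)] by (cases e) (auto simp: fx_butlast)
  have "hd e \<noteq> x (i - 1)"
  proof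
    assume "hd e = x (i - 1)"
    then have "e = factor x (i - 1) (Suc m)" using e_eq by (simp add: factor_Cons)
    then show False using e(3) gp fx by simp
  qed
  moreover obtain f j where f: "f \<in> lang (Suc m) Y" "butlast f = butlast (g j)" "tl f \<notin> butlast ` set p"
    using out set_g unfolding has_outgoing_arc_def G by (metis imageE)
  have f_eq: "f = factor x j m @ [last f]"
    using f(1,2) length_lang[OF f(1)] by (metis append_butlast_last_id fx_butlast list.size(3) nat.distinct(1))
  have "last f \<noteq> x (j + int m)"
  proof
    assume "last f = x (j + int m)"
    then have "f = g j" using f_eq fx by (simp add: factor_Suc)
    then have "tl f = butlast (g (j + 1))" using step by simp
    then show False using f(3) gp by blast
  qed
  ultimately show ?thesis
    unfolding middle_cycle_def using l per e e_eq f f_eq fx gp pW by (metis subsetD)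
qed

theorem not_NMC_imp_not_determined:
  assumes Y: "shift_of_finite_type Y" "\<not> NMC Y"
  shows "\<not> lang_determined Y"
proof -
  obtain r where "\<And>m. r \<le> m \<Longrightarrow> sft (Suc m) (lang (Suc m) Y) = Y"
    using sft_lang_eq[OF Y(1)] by blast
  \<comment> \<open>The length \<open>m = Suc r\<close> satisfies both \<open>r \<le> m\<close> and
    \<open>1 \<le> m\<close>.\<close>
  then have "sft (Suc (Suc r)) (lang (Suc (Suc r)) Y) = Y" by simp
  moreover have "subshift Y" using Y(1) by (simp add: shift_of_finite_type_def)
  ultimately show ?thesis
    using middle_cycle_imp_not_determined[OF extendable_lang not_NMC_imp_middle_cycle[OF Y(2)]]
    by (metis One_nat_def Suc_le_mono zero_le)
qed

section \<open>The topology of the space of subshifts\<close>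

text \<open>Equality of languages passes to shorter words, so the lengths at which two subshifts
  differ form a final segment, and its minimum exceeds \<open>n\<close> exactly if they agree at
  \<open>n\<close>.\<close>

lemma subshift_dist_less_iff:
  assumes "subshift X" "subshift Z"
  shows "subshift_dist X Z < (1 / 2) ^ n \<longleftrightarrow> lang n X = lang n Z"
proof (cases "X = Z")
  case True
  then show ?thesis by (simp add: subshift_dist_def)
next
  case False
  define D where "D = {n. lang n X \<noteq> lang n Z}"
  have "D \<noteq> {}" using False assms subshift_eqI unfolding D_def by blast
  then have "Inf D \<in> D" by (rule Inf_nat_def1)
  have "subshift_dist X Z < (1 / 2) ^ n \<longleftrightarrow> n < Inf D"
    using False by (simp add: subshift_dist_def D_def power_strict_decreasing_iff)
  also have "\<dots> \<longleftrightarrow> lang n X = lang n Z"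
  proof
    assume "n < Inf D"
    then have "n \<notin> D" by (meson cInf_lower bdd_below_bot not_less)
    then show "lang n X = lang n Z" by (simp add: D_def)
  next
    assume eq: "lang n X = lang n Z"
    show "n < Inf D"
    proof (rule ccontr)
      assume "\<not> n < Inf D"
      then have "lang (Inf D) X = lang (Inf D) Z" using lang_eq_mono[OF eq, of "Inf D"] by simp
      then show False using \<open>Inf D \<in> D\<close> by (simp add: D_def)
    qed
  qed
  finally show ?thesis .
qed

definition subshifts_of :: "(int \<Rightarrow> int) set \<Rightarrow> (int \<Rightarrow> int) set set" where
  "subshifts_of Y = {X. subshift X \<and> X \<subseteq> Y}"

lemma Submetric_subshifts_of: "Submetric (Collect subshift) subshift_dist (subshifts_of Y)"
  by unfold_locales (auto simp: subshifts_of_def)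

lemma subshifts_in_eq_mtopology:
  "subshifts_in Y = Metric_space.mtopology (subshifts_of Y) subshift_dist"
  using Submetric.mtopology_submetric[OF Submetric_subshifts_of]
  by (simp add: subshifts_in_def subshifts_of_def)

lemma topspace_subshifts_in [simp]: "topspace (subshifts_in Y) = subshifts_of Y"
  by (auto simp: subshifts_in_def subshifts_of_def)

lemma metrizable_subshifts_in: "metrizable_space (subshifts_in Y)"
  unfolding subshifts_in_def
  by (intro metrizable_space_subtopology subshift_space.metrizable_space_mtopology)

lemma openin_subshifts_in_iff:
  "openin (subshifts_in Y) U \<longleftrightarrow>
     U \<subseteq> subshifts_of Y \<and> (\<forall>X\<in>U. \<exists>n. \<forall>Z\<in>subshifts_of Y. lang n Z = lang n X \<longrightarrow> Z \<in> U)"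
proof -
  interpret S: Submetric "Collect subshift" subshift_dist "subshifts_of Y"
    by (rule Submetric_subshifts_of)
  have dist: "subshift_dist X Z < (1 / 2) ^ n \<longleftrightarrow> lang n Z = lang n X"
    if "X \<in> subshifts_of Y" "Z \<in> subshifts_of Y" for X Z n
    using that subshift_dist_less_iff[of X Z n] by (auto simp: subshifts_of_def)
  have "(\<exists>r>0. S.sub.mball X r \<subseteq> U) \<longleftrightarrow> (\<exists>n. \<forall>Z\<in>subshifts_of Y. lang n Z = lang n X \<longrightarrow> Z \<in> U)"
    if X: "X \<in> subshifts_of Y" for X
  proof
    assume "\<exists>r>0. S.sub.mball X r \<subseteq> U"
    then obtain r where r: "r > 0" "S.sub.mball X r \<subseteq> U" by blast
    obtain n where n: "(1 / 2) ^ n < r" using real_arch_pow_inv[of r "1 / 2"] r(1) by auto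
    have "Z \<in> U" if "Z \<in> subshifts_of Y" "lang n Z = lang n X" for Z
    proof -
      have "subshift_dist X Z < r" using dist[OF X that(1), of n] that(2) n by simp
      then show ?thesis using r(2) X that(1) by auto
    qed
    then show "\<exists>n. \<forall>Z\<in>subshifts_of Y. lang n Z = lang n X \<longrightarrow> Z \<in> U" by blast
  next
    assume "\<exists>n. \<forall>Z\<in>subshifts_of Y. lang n Z = lang n X \<longrightarrow> Z \<in> U"
    then obtain n where n: "\<And>Z. Z \<in> subshifts_of Y \<Longrightarrow> lang n Z = lang n X \<Longrightarrow> Z \<in> U" by blast
    have "S.sub.mball X ((1 / 2) ^ n) \<subseteq> U" using n dist X by auto
    then show "\<exists>r>0. S.sub.mball X r \<subseteq> U" by (intro exI[of _ "(1 / 2) ^ n"]) simp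
  qed
  then show ?thesis
    unfolding subshifts_in_eq_mtopology S.sub.openin_mtopology by blast
qed

lemma openin_subshifts_inD:
  assumes "openin (subshifts_in Y) U" "X \<in> U"
  shows "\<exists>n. \<forall>Z\<in>subshifts_of Y. lang n Z = lang n X \<longrightarrow> Z \<in> U"
  using assms(1)[unfolded openin_subshifts_in_iff] assms(2) by (elim conjE) (rule bspec)

lemma clopenin_subshifts_in_lang:
  "openin (subshifts_in Y) {X \<in> subshifts_of Y. P (lang n X)}"
  "closedin (subshifts_in Y) {X \<in> subshifts_of Y. P (lang n X)}"
proof -
  have *: "openin (subshifts_in Y) {X \<in> subshifts_of Y. P (lang n X)}" for P
    unfolding openin_subshifts_in_iff by (auto intro!: exI[of _ n])
  show "openin (subshifts_in Y) {X \<in> subshifts_of Y. P (lang n X)}" by (rule *)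
  have "subshifts_of Y - {X \<in> subshifts_of Y. P (lang n X)} = {X \<in> subshifts_of Y. \<not> P (lang n X)}"
    by blast
  then show "closedin (subshifts_in Y) {X \<in> subshifts_of Y. P (lang n X)}"
    using *[of "\<lambda>W. \<not> P W"] unfolding closedin_def by auto
qed

lemma zero_dimensional_subshifts_in: "zero_dimensional (subshifts_in Y)"
  unfolding zero_dimensional_def neighbourhood_base_of
proof (intro allI impI)
  fix W X assume "openin (subshifts_in Y) W \<and> X \<in> W"
  then have W: "openin (subshifts_in Y) W" "X \<in> W" by auto
  obtain n where "\<forall>Z\<in>subshifts_of Y. lang n Z = lang n X \<longrightarrow> Z \<in> W"
    using openin_subshifts_inD[OF W] by (rule exE)
  note n = this[rule_format]
  define V where "V = {Z \<in> subshifts_of Y. lang n Z = lang n X}"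
  have "openin (subshifts_in Y) V" "closedin (subshifts_in Y) V"
    unfolding V_def by (rule clopenin_subshifts_in_lang)+
  moreover have "X \<in> V" using openin_subset[OF W(1)] W(2) by (auto simp: V_def)
  moreover have "V \<subseteq> W" using n by (auto simp: V_def)
  ultimately show "\<exists>U V. openin (subshifts_in Y) U \<and>
      (openin (subshifts_in Y) V \<and> closedin (subshifts_in Y) V) \<and> X \<in> U \<and> U \<subseteq> V \<and> V \<subseteq> W"
    by blast
qed

subsection \<open>Compactness\<close>

lemma inj_shift: "inj shift"
proof (rule injI)
  fix x y assume eq: "shift x = shift y"
  show "x = y"
  proof
    fix i show "x i = y i" using fun_cong[OF eq, of "i - 1"] by (simp add: shift_def)
  qed
qed

text \<open>The union is again a subshift and has the language of \<open>Y\<close>, so the criterion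
  for equal languages applies to it.\<close>

lemma subset_if_lang_subset:
  assumes "subshift X" "subshift Y" "\<And>n. lang n X \<subseteq> lang n Y"
  shows "X \<subseteq> Y"
proof -
  have "subshift (X \<union> Y)"
    using assms(1,2) by (auto simp: subshift_def image_Un)
  moreover have "lang n (X \<union> Y) = lang n X \<union> lang n Y" for n
    by (auto simp: lang_eq_factor)
  then have "lang n (X \<union> Y) = lang n Y" for n using assms(3) by blast
  ultimately show ?thesis using subshift_subset_if_lang_eq assms(2) by blast
qed

lemma compact_decreasing_nonempty:
  fixes C :: "nat \<Rightarrow> (int \<Rightarrow> int) set"
  assumes "compact (C 0)" "\<And>n. closed (C n)" "\<And>n. C n \<noteq> {}" "\<And>n. C (Suc n) \<subseteq> C n"
  shows "\<Inter>(range C) \<noteq> {}"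
proof (rule compact_space_imp_nest)
  have anti: "C j \<subseteq> C i" if "i \<le> j" for i j
    using lift_Suc_antimono_le[of C i j] assms(4) that by blast
  show "compact_space (top_of_set (C 0))"
    using assms(1) by (simp add: compact_space_subtopology)
  show "closedin (top_of_set (C 0)) (C n)" for n
    using assms(2) anti by (intro closed_subset) auto
  show "antimono_on UNIV C" using anti by (auto intro: monotone_onI)
qed (use assms in auto)

text \<open>The limit is the intersection of decreasing finite type shifts \<open>K n\<close>. That
  no word is lost in it is a compactness argument.\<close>

lemma subshift_limit:
  fixes \<tau> :: "nat \<Rightarrow> (int \<Rightarrow> int) set"
  assumes sub: "\<And>n. subshift (\<tau> n)" and compat: "\<And>n. lang n (\<tau> (Suc n)) = lang n (\<tau> n)"
  shows "\<exists>X. subshift X \<and> (\<forall>n. lang n X = lang n (\<tau> n))"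
proof -
  define K where "K n = sft (Suc n) (lang (Suc n) (\<tau> (Suc n)))" for n
  define X where "X = (\<Inter>n. K n)"
  have "K (Suc n) \<subseteq> K n" for n
  proof
    fix x assume x: "x \<in> K (Suc n)"
    have "factor x i (Suc n) \<in> lang (Suc n) (\<tau> (Suc n))" for i
    proof -
      have "factor x i (Suc (Suc n)) \<in> lang (Suc (Suc n)) (\<tau> (Suc (Suc n)))"
        using x by (simp add: K_def sft_iff)
      then have "factor x i (Suc n) \<in> lang (Suc n) (\<tau> (Suc (Suc n)))"
        using butlast_factor butlast_lang by (metis image_eqI)
      then show ?thesis using compat by simp
    qed
    then show "x \<in> K n" by (simp add: K_def sft_iff)
  qed
  then have K_anti: "K j \<subseteq> K i" if "i \<le> j" for i j
    using lift_Suc_antimono_le[of K i j] that by blast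
  have K_closed: "closed (K n)" and K_compact: "compact (K n)" for n
    unfolding K_def by (rule closed_sft, rule compact_sft[OF finite_lang[OF sub]])
  have lang_\<tau>: "lang n (\<tau> (n + j)) = lang n (\<tau> n)" for n j
  proof (induction j)
    case (Suc j)
    have "lang n (\<tau> (Suc (n + j))) = lang n (\<tau> (n + j))"
      by (rule lang_eq_mono[OF compat]) simp
    then show ?case using Suc by simp
  qed simp
  have lang_X: "lang n X = lang n (\<tau> n)" for n
  proof
    show "lang n X \<subseteq> lang n (\<tau> n)"
    proof
      fix w assume "w \<in> lang n X"
      then obtain x i where x: "x \<in> X" "w = factor x i n" by (auto simp: lang_eq_factor)
      then have "factor x i (Suc n) \<in> lang (Suc n) (\<tau> (Suc n))" by (simp add: X_def K_def sft_iff)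
      then have "w \<in> lang n (\<tau> (Suc n))"
        using x butlast_factor butlast_lang by (metis image_eqI)
      then show "w \<in> lang n (\<tau> n)" using compat by simp
    qed
    show "lang n (\<tau> n) \<subseteq> lang n X"
    proof
      fix w assume w: "w \<in> lang n (\<tau> n)"
      \<comment> \<open>Fixing the word at position 0 turns its occurrences into closed conditions;
        shift invariance makes each \<open>C j\<close> nonempty.\<close>
      define C where "C j = K (n + j) \<inter> {x. factor x 0 n \<in> {w}}" for j
      have "\<Inter>(range C) \<noteq> {}"
      proof (rule compact_decreasing_nonempty)
        show "compact (C 0)" unfolding C_def by (intro compact_Int_closed K_compact closed_factor)
        show "closed (C j)" for j unfolding C_def by (intro closed_Int K_closed closed_factor)
        show "C (Suc j) \<subseteq> C j" for j using K_anti[of "n + j" "n + Suc j"] by (auto simp: C_def)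
        show "C j \<noteq> {}" for j
        proof -
          have "w \<in> lang n (\<tau> (Suc (n + j)))" using w lang_\<tau>[of n "Suc j"] by simp
          then obtain x where x: "x \<in> \<tau> (Suc (n + j))" "factor x 0 n = w"
            using lang_translate[OF _ sub] by blast
          then have "x \<in> K (n + j)" unfolding K_def using subset_sft_lang by blast
          then show ?thesis using x by (auto simp: C_def)
        qed
      qed
      then obtain x where x: "\<And>j. x \<in> C j" by blast
      have "x \<in> K j" for j using x[of j] K_anti[of j "n + j"] by (auto simp: C_def)
      then have "x \<in> X" by (simp add: X_def)
      moreover have "factor x 0 n = w" using x[of 0] by (simp add: C_def)
      ultimately show "w \<in> lang n X" using factor_in_lang by blast
    qed
  qed
  have "X \<noteq> {}" using lang_X[of 0] lang_nonempty[OF sub, of 0 0] by (auto simp: lang_eq_factor)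
  moreover have "compact X"
  proof -
    have "compact (K 0 \<inter> (\<Inter>n. K n))"
      by (intro compact_Int_closed K_compact closed_INT ballI K_closed)
    moreover have "K 0 \<inter> (\<Inter>n. K n) = X" by (auto simp: X_def)
    ultimately show ?thesis by simp
  qed
  moreover have "shift ` X = X"
    unfolding X_def by (simp add: image_INT[OF inj_shift, of _ _ 0] K_def shift_image_sft)
  ultimately have "subshift X" by (simp add: subshift_def)
  then show ?thesis using lang_X by blast
qed

text \<open>Along a Cauchy sequence the words of each length settle, and
  \<open>subshift_limit\<close> applies to the settled stages. Total boundedness reflects that
  \<open>lang n Y\<close> has finitely many subsets.\<close>

lemma compact_space_subshifts_in:
  assumes Y: "subshift Y"
  shows "compact_space (subshifts_in Y)"
proof -
  interpret S: Submetric "Collect subshift" subshift_dist "subshifts_of Y"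
    by (rule Submetric_subshifts_of)
  have sub: "subshift X" if "X \<in> subshifts_of Y" for X using that by (simp add: subshifts_of_def)
  have "S.sub.mcomplete"
    unfolding S.sub.mcomplete_def
  proof (intro allI impI)
    fix \<sigma> :: "nat \<Rightarrow> _" assume \<sigma>: "S.sub.MCauchy \<sigma>"
    then have \<sigma>Y: "\<sigma> k \<in> subshifts_of Y" for k unfolding S.sub.MCauchy_def by blast
    have "\<exists>N. \<forall>k\<ge>N. lang n (\<sigma> k) = lang n (\<sigma> N)" for n
    proof -
      have "(0::real) < (1 / 2) ^ n" by simp
      then obtain N where "\<And>k k'. N \<le> k \<Longrightarrow> N \<le> k' \<Longrightarrow> subshift_dist (\<sigma> k) (\<sigma> k') < (1 / 2) ^ n"
        using \<sigma> unfolding S.sub.MCauchy_def by blast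
      then have "\<forall>k\<ge>N. lang n (\<sigma> k) = lang n (\<sigma> N)"
        using subshift_dist_less_iff sub \<sigma>Y by (meson order_refl)
      then show ?thesis ..
    qed
    then obtain N where N: "\<And>n k. k \<ge> N n \<Longrightarrow> lang n (\<sigma> k) = lang n (\<sigma> (N n))" by metis
    have "lang n (\<sigma> (N (Suc n))) = lang n (\<sigma> (N n))" for n
    proof -
      define k where "k = max (N n) (N (Suc n))"
      have "lang (Suc n) (\<sigma> k) = lang (Suc n) (\<sigma> (N (Suc n)))" by (rule N) (simp add: k_def)
      then have "lang n (\<sigma> k) = lang n (\<sigma> (N (Suc n)))" by (metis butlast_lang)
      moreover have "lang n (\<sigma> k) = lang n (\<sigma> (N n))" by (rule N) (simp add: k_def)
      ultimately show ?thesis by simp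
    qed
    then obtain X where X: "subshift X" "\<And>n. lang n X = lang n (\<sigma> (N n))"
      using subshift_limit[of "\<lambda>n. \<sigma> (N n)"] sub \<sigma>Y by blast
    have "lang n X \<subseteq> lang n Y" for n
      unfolding X(2) using \<sigma>Y by (intro lang_mono) (simp add: subshifts_of_def)
    then have XY: "X \<in> subshifts_of Y" using subset_if_lang_subset X(1) Y by (simp add: subshifts_of_def)
    have "limitin S.sub.mtopology \<sigma> X sequentially"
      unfolding S.sub.limit_metric_sequentially
    proof (intro conjI allI impI)
      fix \<epsilon> :: real assume "\<epsilon> > 0"
      then obtain n where n: "(1 / 2) ^ n < \<epsilon>" using real_arch_pow_inv[of \<epsilon> "1 / 2"] by auto
      have "\<sigma> k \<in> subshifts_of Y \<and> subshift_dist (\<sigma> k) X < \<epsilon>" if "k \<ge> N n" for k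
      proof -
        have "lang n (\<sigma> k) = lang n X" using N[OF that] X(2) by simp
        then have "subshift_dist (\<sigma> k) X < (1 / 2) ^ n"
          using subshift_dist_less_iff sub \<sigma>Y X(1) by blast
        then show ?thesis using n \<sigma>Y by auto
      qed
      then show "\<exists>N. \<forall>n\<ge>N. \<sigma> n \<in> subshifts_of Y \<and> subshift_dist (\<sigma> n) X < \<epsilon>" by blast
    qed (rule XY)
    then show "\<exists>X. limitin S.sub.mtopology \<sigma> X sequentially" ..
  qed
  moreover have "S.sub.mtotally_bounded (subshifts_of Y)"
    unfolding S.sub.mtotally_bounded_def
  proof (intro allI impI)
    fix \<epsilon> :: real assume "\<epsilon> > 0"
    then obtain n where n: "(1 / 2) ^ n < \<epsilon>" using real_arch_pow_inv[of \<epsilon> "1 / 2"] by auto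
    define rep where "rep W = (SOME Z. Z \<in> subshifts_of Y \<and> lang n Z = W)" for W
    have rep: "rep (lang n X) \<in> subshifts_of Y \<and> lang n (rep (lang n X)) = lang n X"
      if "X \<in> subshifts_of Y" for X
      unfolding rep_def by (rule someI) (use that in blast)
    have "lang n ` subshifts_of Y \<subseteq> Pow (lang n Y)"
      using lang_mono by (auto simp: subshifts_of_def)
    then have "finite (lang n ` subshifts_of Y)"
      by (rule finite_subset) (simp add: finite_lang Y)
    then have "finite (rep ` lang n ` subshifts_of Y)" by simp
    moreover have "rep ` lang n ` subshifts_of Y \<subseteq> subshifts_of Y" using rep by blast
    moreover have "X \<in> S.sub.mball (rep (lang n X)) \<epsilon>" if "X \<in> subshifts_of Y" for X
    proof -
      have "subshift_dist (rep (lang n X)) X < (1 / 2) ^ n"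
        using rep[OF that] that sub subshift_dist_less_iff by blast
      then show ?thesis using rep[OF that] that n by auto
    qed
    ultimately show "\<exists>K. finite K \<and> K \<subseteq> subshifts_of Y \<and> subshifts_of Y \<subseteq> (\<Union>X\<in>K. S.sub.mball X \<epsilon>)"
      by (intro exI[of _ "rep ` lang n ` subshifts_of Y"]) blast
  qed
  ultimately show ?thesis
    unfolding subshifts_in_eq_mtopology S.sub.compact_space_eq_mcomplete_mtotally_bounded by blast
qed

section \<open>Subshifts of a shift of finite type\<close>

text \<open>Beyond the window of \<open>Y\<close>, the words of \<open>Z\<close> alone decide
  whether \<open>Z\<close> lies in \<open>Y\<close>. Thus the subshifts of \<open>Y\<close> form an
  open set of subshifts, with a uniform radius.\<close>

lemma shift_of_finite_type_neighbourhood: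
  assumes "shift_of_finite_type Y"
  shows "\<exists>r. \<forall>X Z n. X \<subseteq> Y \<longrightarrow> r \<le> n \<longrightarrow> lang n Z = lang n X \<longrightarrow> Z \<subseteq> Y"
proof -
  obtain r where r: "\<And>m. r \<le> m \<Longrightarrow> sft (Suc m) (lang (Suc m) Y) = Y"
    using sft_lang_eq[OF assms] by blast
  have "Z \<subseteq> Y" if XY: "X \<subseteq> Y" and n: "Suc r \<le> n" and eq: "lang n Z = lang n X" for X Z n
  proof -
    obtain m where m: "n = Suc m" "r \<le> m" using n by (cases n) auto
    have "Z \<subseteq> sft n (lang n Z)" by (rule subset_sft_lang)
    also have "\<dots> \<subseteq> sft n (lang n Y)"
    proof
      fix x assume x: "x \<in> sft n (lang n Z)"
      have "factor x i n \<in> lang n Y" for i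
      proof -
        have "factor x i n \<in> lang n X" using x eq by (simp add: sft_iff)
        then show ?thesis by (rule subsetD[OF lang_mono[OF XY]])
      qed
      then show "x \<in> sft n (lang n Y)" by (simp add: sft_iff)
    qed
    also have "\<dots> = Y" using r m by simp
    finally show ?thesis .
  qed
  then show ?thesis by (intro exI[of _ "Suc r"]) simp
qed

lemma isolated_points_subshifts_in:
  assumes Y: "shift_of_finite_type Y"
  shows "isolated_points (subshifts_in Y) = {X \<in> subshifts_of Y. lang_determined X}"
proof -
  obtain r where "\<forall>X Z n. X \<subseteq> Y \<longrightarrow> r \<le> n \<longrightarrow> lang n Z = lang n X \<longrightarrow> Z \<subseteq> Y"
    using shift_of_finite_type_neighbourhood[OF Y] by (rule exE)
  note r = this[rule_format]
  have "openin (subshifts_in Y) {X} \<longleftrightarrow> lang_determined X" if X: "X \<in> subshifts_of Y" for X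
  proof
    assume "lang_determined X"
    then show "openin (subshifts_in Y) {X}"
      using X unfolding openin_subshifts_in_iff lang_determined_def by (auto simp: subshifts_of_def)
  next
    assume op: "openin (subshifts_in Y) {X}"
    obtain n where "\<forall>Z\<in>subshifts_of Y. lang n Z = lang n X \<longrightarrow> Z \<in> {X}"
      using openin_subshifts_inD[OF op singletonI] by (rule exE)
    note n = this[rule_format]
    \<comment> \<open>Length \<open>r\<close> forces \<open>Z\<close> into \<open>Y\<close>, length
      \<open>n\<close> then forces \<open>Z = X\<close>.\<close>
    have "Z = X" if "subshift Z" "lang (max n r) Z = lang (max n r) X" for Z
    proof (rule singletonD, rule n)
      have "X \<subseteq> Y" using X by (simp add: subshifts_of_def)
      then have "Z \<subseteq> Y" using r[of X "max n r" Z] that(2) by simp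
      then show "Z \<in> subshifts_of Y" using that(1) by (simp add: subshifts_of_def)
      show "lang n Z = lang n X" by (rule lang_eq_mono[OF that(2)]) simp
    qed
    then show "lang_determined X" unfolding lang_determined_def by blast
  qed
  then show ?thesis by (auto simp: isolated_points_def)
qed

lemma isolated_points_dense_subshifts_in:
  assumes Y: "shift_of_finite_type Y"
  shows "subshifts_in Y closure_of isolated_points (subshifts_in Y) = topspace (subshifts_in Y)"
proof
  show "topspace (subshifts_in Y) \<subseteq> subshifts_in Y closure_of isolated_points (subshifts_in Y)"
  proof
    fix X assume "X \<in> topspace (subshifts_in Y)"
    then have X: "subshift X" "X \<subseteq> Y" by (auto simp: subshifts_of_def)
    obtain r where "\<forall>X Z n. X \<subseteq> Y \<longrightarrow> r \<le> n \<longrightarrow> lang n Z = lang n X \<longrightarrow> Z \<subseteq> Y"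
      using shift_of_finite_type_neighbourhood[OF Y] by (rule exE)
    note r = this[rule_format]
    have "\<exists>Z. Z \<in> isolated_points (subshifts_in Y) \<and> Z \<in> U"
      if U: "X \<in> U" "openin (subshifts_in Y) U" for U
    proof -
      obtain n where "\<forall>Z\<in>subshifts_of Y. lang n Z = lang n X \<longrightarrow> Z \<in> U"
        using openin_subshifts_inD[OF U(2,1)] by (rule exE)
      note n = this[rule_format]
      obtain Z where Z: "subshift Z" "lang_determined Z" "lang (max n r) Z = lang (max n r) X"
        using lang_determined_dense[OF X(1)] by blast
      have "Z \<subseteq> Y" using r[OF X(2) _ Z(3)] by simp
      then have ZY: "Z \<in> subshifts_of Y" using Z(1) by (simp add: subshifts_of_def)
      have "lang n Z = lang n X" by (rule lang_eq_mono[OF Z(3)]) simp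
      then show ?thesis using n ZY Z(2) isolated_points_subshifts_in[OF Y] by blast
    qed
    then show "X \<in> subshifts_in Y closure_of isolated_points (subshifts_in Y)"
      using X by (auto simp: in_closure_of subshifts_of_def)
  qed
qed (rule closure_of_subset_topspace)

lemma remainder_homeomorphic_cantor_set:
  assumes Y: "shift_of_finite_type Y" "\<not> NMC Y"
  shows "subtopology (subshifts_in Y) (topspace (subshifts_in Y) - isolated_points (subshifts_in Y))
    homeomorphic_space top_of_set cantor_set"
proof -
  define R where "R = topspace (subshifts_in Y) - isolated_points (subshifts_in Y)"
  define K where "K = subtopology (subshifts_in Y) R"
  have subY: "subshift Y" using Y(1) by (simp add: shift_of_finite_type_def)
  have R: "R = {X \<in> subshifts_of Y. \<not> lang_determined X}"
    using isolated_points_subshifts_in[OF Y(1)] by (auto simp: R_def)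
  have tK: "topspace K = R" by (auto simp: K_def R)
  \<comment> \<open>The separating clopen sets ask whether the \<open>i\<close>-th word over the
    integers occurs in the subshift.\<close>
  define B where "B i = {X \<in> R. (from_nat i :: int list) \<in> lang (length (from_nat i :: int list)) X}" for i
  show ?thesis
    unfolding R_def[symmetric] K_def[symmetric]
  proof (rule homeomorphic_cantor_set)
    have "closedin (subshifts_in Y) R"
      unfolding R_def by (intro closedin_diff closedin_topspace openin_isolated_points order_refl)
    then show "compact_space K"
      unfolding K_def
      by (intro compact_space_subtopology closedin_compact_space compact_space_subshifts_in subY)
    \<comment> \<open>The failure of NMC enters here: \<open>Y\<close> itself is a non-isolated
      point.\<close>
    have "Y \<in> R" using not_NMC_imp_not_determined[OF Y] subY by (simp add: R subshifts_of_def)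
    then show "topspace K \<noteq> {}" using tK by blast
    show "\<not> openin K {X}" if "X \<in> topspace K" for X
    proof
      assume "openin K {X}"
      then obtain U where U: "openin (subshifts_in Y) U" "{X} = U \<inter> R"
        unfolding K_def openin_subtopology by blast
      have XU: "X \<in> U" using U(2) by blast
      obtain n where "\<forall>Z\<in>subshifts_of Y. lang n Z = lang n X \<longrightarrow> Z \<in> U"
        using openin_subshifts_inD[OF U(1) XU] by (rule exE)
      note n = this[rule_format]
      have X: "subshift X" "X \<subseteq> Y" "\<not> lang_determined X"
        using that tK R by (auto simp: subshifts_of_def)
      obtain r where "\<forall>X Z n. X \<subseteq> Y \<longrightarrow> r \<le> n \<longrightarrow> lang n Z = lang n X \<longrightarrow> Z \<subseteq> Y"
        using shift_of_finite_type_neighbourhood[OF Y(1)] by (rule exE)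
      note r = this[rule_format]
      obtain Z where Z: "subshift Z" "\<not> lang_determined Z" "Z \<noteq> X" "lang (max n r) Z = lang (max n r) X"
        using not_determined_perfect[OF X(1,3)] by blast
      have "Z \<subseteq> Y" using r[OF X(2) _ Z(4)] by simp
      then have ZY: "Z \<in> subshifts_of Y" using Z(1) by (simp add: subshifts_of_def)
      moreover have "lang n Z = lang n X" by (rule lang_eq_mono[OF Z(4)]) simp
      ultimately have "Z \<in> U \<inter> R" using n Z(2) R by blast
      then show False using U(2) Z(3) by blast
    qed
    have B: "B i = R \<inter> {X \<in> subshifts_of Y. (from_nat i :: int list) \<in> lang (length (from_nat i :: int list)) X}" for i
      by (auto simp: B_def R)
    show "openin K (B i)" "closedin K (B i)" for i
      unfolding K_def B openin_subtopology closedin_subtopology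
      using clopenin_subshifts_in_lang[of Y "\<lambda>L. (from_nat i :: int list) \<in> L" "length (from_nat i :: int list)"]
      by blast+
    show "\<exists>i. X \<in> B i \<longleftrightarrow> Z \<notin> B i" if XZ: "X \<in> topspace K" "Z \<in> topspace K" "X \<noteq> Z" for X Z
    proof -
      have "subshift X" "subshift Z" using XZ tK R by (auto simp: subshifts_of_def)
      then obtain n where "lang n X \<noteq> lang n Z" using subshift_eqI XZ(3) by blast
      then obtain w where w: "w \<in> lang n X \<longleftrightarrow> w \<notin> lang n Z" by blast
      then have "length w = n" using length_lang by blast
      then have "X \<in> B (to_nat w) \<longleftrightarrow> Z \<notin> B (to_nat w)" using w XZ(1,2) tK by (simp add: B_def)
      then show ?thesis ..
    qed
  qed
qed

theorem pelczynski_space_subshifts_in: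
  assumes "shift_of_finite_type Y" "\<not> NMC Y"
  shows "pelczynski_space (subshifts_in Y)"
  unfolding pelczynski_space_def
  using assms compact_space_subshifts_in[of Y] metrizable_subshifts_in zero_dimensional_subshifts_in
    isolated_points_dense_subshifts_in remainder_homeomorphic_cantor_set
  by (simp add: shift_of_finite_type_def)

theorem pelczynski_space_unique:
  assumes P: "pelczynski_space P" and Q: "pelczynski_space Q"
  shows "P homeomorphic_space Q"
proof (rule homeomorphic_if_homeomorphic_remainders)
  have hP: "subtopology P (topspace P - isolated_points P) homeomorphic_space top_of_set cantor_set"
    and hQ: "subtopology Q (topspace Q - isolated_points Q) homeomorphic_space top_of_set cantor_set"
    using P Q by (simp_all add: pelczynski_space_def)
  then show "subtopology P (topspace P - isolated_points P) homeomorphic_space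
      subtopology Q (topspace Q - isolated_points Q)"
    using homeomorphic_space_trans homeomorphic_space_sym[THEN iffD1] by metis
  show "topspace P - isolated_points P \<noteq> {}"
  proof
    assume E: "topspace P - isolated_points P = {}"
    have "subtopology P (topspace P - isolated_points P) = trivial_topology" unfolding E by simp
    then have "top_of_set cantor_set = trivial_topology"
      using homeomorphic_empty_space[OF hP] by (rule iffD1[rotated])
    then have "cantor_set = {}" by (metis topspace_euclidean_subtopology topspace_discrete_topology)
    then show False by (simp add: cantor_set_eq_range)
  qed
qed (use P Q in \<open>simp_all add: pelczynski_space_def\<close>)

theorem corollary4p3:
  fixes Y :: "(int \<Rightarrow> int) set"
  assumes "shift_of_finite_type Y" and "\<not> NMC Y"
  shows "pelczynski_space (subshifts_in Y) \<and>
         (\<forall>P :: 'p topology. pelczynski_space P \<longrightarrow> subshifts_in Y homeomorphic_space P) \<and>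
         (\<forall>Z. shift_of_finite_type Z \<and> \<not> NMC Z \<longrightarrow>
              subshifts_in Y homeomorphic_space subshifts_in Z)"
proof (intro conjI allI impI)
  show Y: "pelczynski_space (subshifts_in Y)" using assms by (rule pelczynski_space_subshifts_in)
  show "subshifts_in Y homeomorphic_space P" if "pelczynski_space P" for P :: "'p topology"
    using Y that by (rule pelczynski_space_unique)
  show "subshifts_in Y homeomorphic_space subshifts_in Z" if "shift_of_finite_type Z \<and> \<not> NMC Z" for Z
    by (rule pelczynski_space_unique[OF Y]) (use that pelczynski_space_subshifts_in in simp)
qed

end
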